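(* Let $X$ be a Banach space, and let $d$ be a degree such that $X$ is $d$-large. Then there exists a $d$-large subspace $Y\subseteq X$ which either has a $d$-better UFDD, or is hereditarily $d$-indecomposable.
   Context: All Banach spaces are real. "Banach space" means infinite-dimensional Banach space and "subspace" means infinite-dimensional closed linear subspace, unless finite dimension is explicitly allowed. Direct sums are topological direct sums. Degrees. An approximation pair is a pair $(X,F)$ where $X$ is a finite- or infinite-dimensional Banach space and $F$ is a finite-dimensional subspace of $X$. A morphism from $(X,F)$ to $(Y,G)$ is a pair $\varphi=(S,T)$ of bounded linear operators $S\colon G\to F$, $T\colon X\to Y$ such that $T(S(g))=g$ for all $g\in G$; its norm is $\|\varphi\|=\|S\|\cdot\|T\|$ if $G\neq\{0\}$ and $\|\varphi\|=1$ if $G=\{0\}$. A degree is a map $d$ assigning to every approximation pair $(X,F)$ a number $d(X,F)\in[0,\infty)$, for which there is a function $K_d\colon[1,\infty)\times[0,\infty)\to[0,\infty)$, non-decreasing in both variables, with $\lim_{s\to1}K_d(s,t)=t$ for all $t\ge 0$, such that $d(Y,G)\le K_d(\|\varphi\|,d(X,F))$ for every morphism $\varphi\colon(X,F)\to(Y,G)$. A space $X$ is $d$-small if $\sup_F d(X,F)<\infty$, the supremum being over all finite-dimensional subspaces $F$ of $X$, and $d$-large otherwise. A Banach space is hereditarily $d$-indecomposable if it is $d$-large and no subspace of it is a direct sum of two $d$-large subspaces. FDDs. An FDD of a Banach space $Y$ is a sequence $(F_n)_{n\in\mathbb N}$ of nonzero finite-dimensional subspaces of $Y$ such that every $y\in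 Y$ can be written uniquely as $y=\sum_{n}y_n$ with $y_n\in F_n$. It is a UFDD (unconditional FDD) if, whenever $y_n\in F_n$ for all $n$ and $\sum_n y_n$ converges, this convergence is unconditional. It is $d$-better if $d(Y,F_n)\to\infty$ as $n\to\infty$. *)

theory Defs
  imports "HOL-Analysis.Analysis"
begin

text \<open>
  A degree is evaluated on all Banach spaces, which cannot all be types in a single statement.
  The Banach spaces it is evaluated on are therefore presented as pairs \<open>(V, N)\<close>: a linear subspace
  \<open>V\<close> of a real vector space \<open>'a\<close>, together with any complete norm \<open>N\<close> on \<open>V\<close>, unrelated to whatever
  norm \<open>'a\<close> may carry. The values of \<open>N\<close> outside \<open>V\<close> are irrelevant.
  Every Banach space has this form, for example inside itself.
\<close>

definition fin_dim :: "'a::real_vector set \<Rightarrow> bool" where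
  "fin_dim V \<longleftrightarrow> (\<exists>B. finite B \<and> V \<subseteq> span B)"

definition banach_on :: "'a::real_vector set \<Rightarrow> ('a \<Rightarrow> real) \<Rightarrow> bool" where
  "banach_on V N \<longleftrightarrow>
     subspace V \<and>
     (\<forall>x\<in>V. 0 \<le> N x \<and> (N x = 0 \<longleftrightarrow> x = 0)) \<and>
     (\<forall>c. \<forall>x\<in>V. N (c *\<^sub>R x) = \<bar>c\<bar> * N x) \<and>
     (\<forall>x\<in>V. \<forall>y\<in>V. N (x + y) \<le> N x + N y) \<and>
     (\<forall>\<sigma>::nat \<Rightarrow> 'a. (\<forall>n. \<sigma> n \<in> V) \<and> (\<forall>e>0. \<exists>M. \<forall>m\<ge>M. \<forall>n\<ge>M. N (\<sigma> m - \<sigma> n) < e)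
        \<longrightarrow> (\<exists>x\<in>V. (\<lambda>n. N (\<sigma> n - x)) \<longlonglongrightarrow> 0))"

definition approx_pair :: "'a::real_vector set \<Rightarrow> ('a \<Rightarrow> real) \<Rightarrow> 'a set \<Rightarrow> bool" where
  "approx_pair V N F \<longleftrightarrow> banach_on V N \<and> subspace F \<and> F \<subseteq> V \<and> fin_dim F"

text \<open>Bounded operators from \<open>(V, N)\<close> to \<open>(W, M)\<close>; the values of \<open>T\<close> outside \<open>V\<close> are irrelevant.\<close>

definition bounded_op ::
  "'a::real_vector set \<Rightarrow> ('a \<Rightarrow> real) \<Rightarrow> 'a set \<Rightarrow> ('a \<Rightarrow> real) \<Rightarrow> ('a \<Rightarrow> 'a) \<Rightarrow> bool" where
  "bounded_op V N W M T \<longleftrightarrow>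
     (\<forall>x\<in>V. T x \<in> W) \<and>
     (\<forall>x\<in>V. \<forall>y\<in>V. T (x + y) = T x + T y) \<and>
     (\<forall>c. \<forall>x\<in>V. T (c *\<^sub>R x) = c *\<^sub>R T x) \<and>
     (\<exists>C. \<forall>x\<in>V. M (T x) \<le> C * N x)"

definition op_norm ::
  "'a::real_vector set \<Rightarrow> ('a \<Rightarrow> real) \<Rightarrow> ('a \<Rightarrow> real) \<Rightarrow> ('a \<Rightarrow> 'a) \<Rightarrow> real" where
  "op_norm V N M T = (SUP x\<in>{x\<in>V. N x \<le> 1}. M (T x))"

definition morphism ::
  "'a::real_vector set \<Rightarrow> ('a \<Rightarrow> real) \<Rightarrow> 'a set \<Rightarrow> 'a set \<Rightarrow> ('a \<Rightarrow> real) \<Rightarrow> 'a set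
     \<Rightarrow> ('a \<Rightarrow> 'a) \<Rightarrow> ('a \<Rightarrow> 'a) \<Rightarrow> bool" where
  "morphism V N F W M G S T \<longleftrightarrow>
     bounded_op G M F N S \<and> bounded_op V N W M T \<and> (\<forall>g\<in>G. T (S g) = g)"

definition morphism_norm ::
  "'a::real_vector set \<Rightarrow> ('a \<Rightarrow> real) \<Rightarrow> ('a \<Rightarrow> real) \<Rightarrow> 'a set
     \<Rightarrow> ('a \<Rightarrow> 'a) \<Rightarrow> ('a \<Rightarrow> 'a) \<Rightarrow> real" where
  "morphism_norm V N M G S T = (if G = {0} then 1 else op_norm G M N S * op_norm V N M T)"

definition is_degree :: "('a::real_vector set \<Rightarrow> ('a \<Rightarrow> real) \<Rightarrow> 'a set \<Rightarrow> real) \<Rightarrow> bool" where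
  "is_degree d \<longleftrightarrow>
     (\<forall>V N F. approx_pair V N F \<longrightarrow> 0 \<le> d V N F) \<and>
     (\<exists>K :: real \<Rightarrow> real \<Rightarrow> real.
        (\<forall>s\<ge>1. \<forall>t\<ge>0. 0 \<le> K s t) \<and>
        (\<forall>s s' t t'. 1 \<le> s \<and> s \<le> s' \<and> 0 \<le> t \<and> t \<le> t' \<longrightarrow> K s t \<le> K s' t') \<and>
        (\<forall>t\<ge>0. ((\<lambda>s. K s t) \<longlongrightarrow> t) (at_right 1)) \<and>
        (\<forall>V N F W M G S T.
           approx_pair V N F \<and> approx_pair W M G \<and> morphism V N F W M G S T
           \<longrightarrow> d W M G \<le> K (morphism_norm V N M G S T) (d V N F)))"

definition d_small ::
  "('a::real_vector set \<Rightarrow> ('a \<Rightarrow> real) \<Rightarrow> 'a set \<Rightarrow> real) \<Rightarrow> 'a set \<Rightarrow> ('a \<Rightarrow> real) \<Rightarrow> bool" where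
  "d_small d V N \<longleftrightarrow> bdd_above {d V N F | F. subspace F \<and> F \<subseteq> V \<and> fin_dim F}"

abbreviation d_large ::
  "('a::real_vector set \<Rightarrow> ('a \<Rightarrow> real) \<Rightarrow> 'a set \<Rightarrow> real) \<Rightarrow> 'a set \<Rightarrow> ('a \<Rightarrow> real) \<Rightarrow> bool" where
  "d_large d V N \<equiv> \<not> d_small d V N"

text \<open>
  The space under study and its subspaces are infinite-dimensional closed linear subspaces of a
  Banach space type \<open>'a\<close>, with the norm of \<open>'a\<close>. The ambient type may be the space itself or
  any larger Banach space, so that degrees can be taken on as large a collection of Banach
  spaces as desired.
\<close>

definition inf_closed_subspace :: "'a::banach set \<Rightarrow> bool" where
  "inf_closed_subspace Y \<longleftrightarrow> subspace Y \<and> closed Y \<and> \<not> fin_dim Y"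

lemma banach_on_norm:
  fixes Y :: "'a::banach set"
  assumes "subspace Y" and "closed Y"
  shows "banach_on Y norm"
proof -
  have "\<exists>x\<in>Y. (\<lambda>n. norm (\<sigma> n - x)) \<longlonglongrightarrow> 0"
    if s: "\<forall>n. \<sigma> n \<in> Y" and c: "\<forall>e>0. \<exists>M. \<forall>m\<ge>M. \<forall>n\<ge>M. norm (\<sigma> m - \<sigma> n) < e"
    for \<sigma> :: "nat \<Rightarrow> 'a"
  proof -
    have "Cauchy \<sigma>" using c by (simp add: Cauchy_def dist_norm)
    then obtain x where x: "\<sigma> \<longlonglongrightarrow> x" by (auto simp: Cauchy_convergent_iff convergent_def)
    then have "x \<in> Y" using s assms(2) closed_sequentially by blast
    moreover have "(\<lambda>n. norm (\<sigma> n - x)) \<longlonglongrightarrow> 0"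
      using x LIM_zero tendsto_norm_zero by blast
    ultimately show ?thesis by blast
  qed
  then show ?thesis
    unfolding banach_on_def using assms(1) by (auto simp: norm_triangle_ineq)
qed

text \<open>The last condition makes the projections of \<open>Z\<close> onto \<open>A\<close> and \<open>B\<close> continuous.\<close>

definition topological_direct_sum :: "'a::real_normed_vector set \<Rightarrow> 'a set \<Rightarrow> 'a set \<Rightarrow> bool" where
  "topological_direct_sum Z A B \<longleftrightarrow>
     Z = {a + b | a b. a \<in> A \<and> b \<in> B} \<and> A \<inter> B = {0} \<and>
     (\<exists>C. \<forall>a\<in>A. \<forall>b\<in>B. norm a \<le> C * norm (a + b) \<and> norm b \<le> C * norm (a + b))"

definition hereditarily_indecomposable ::
  "('a::banach set \<Rightarrow> ('a \<Rightarrow> real) \<Rightarrow> 'a set \<Rightarrow> real) \<Rightarrow> 'a set \<Rightarrow> bool" where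
  "hereditarily_indecomposable d Y \<longleftrightarrow>
     d_large d Y norm \<and>
     \<not> (\<exists>Z A B. Z \<subseteq> Y \<and> inf_closed_subspace Z \<and>
          inf_closed_subspace A \<and> inf_closed_subspace B \<and>
          topological_direct_sum Z A B \<and> d_large d A norm \<and> d_large d B norm)"

definition FDD :: "'a::banach set \<Rightarrow> (nat \<Rightarrow> 'a set) \<Rightarrow> bool" where
  "FDD Y F \<longleftrightarrow>
     (\<forall>n. subspace (F n) \<and> F n \<subseteq> Y \<and> fin_dim (F n) \<and> F n \<noteq> {0}) \<and>
     (\<forall>y\<in>Y. \<exists>!f. (\<forall>n. f n \<in> F n) \<and> f sums y)"

definition unconditionally_convergent :: "(nat \<Rightarrow> 'a::banach) \<Rightarrow> bool" where
  "unconditionally_convergent f \<longleftrightarrow> (\<forall>p. bij p \<longrightarrow> summable (\<lambda>n. f (p n)))"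

definition UFDD :: "'a::banach set \<Rightarrow> (nat \<Rightarrow> 'a set) \<Rightarrow> bool" where
  "UFDD Y F \<longleftrightarrow>
     FDD Y F \<and> (\<forall>f. (\<forall>n. f n \<in> F n) \<and> summable f \<longrightarrow> unconditionally_convergent f)"

definition d_better ::
  "('a::banach set \<Rightarrow> ('a \<Rightarrow> real) \<Rightarrow> 'a set \<Rightarrow> real) \<Rightarrow> 'a set \<Rightarrow> (nat \<Rightarrow> 'a set) \<Rightarrow> bool" where
  "d_better d Y F \<longleftrightarrow> filterlim (\<lambda>n. d Y norm (F n)) at_top sequentially"

end

theory Submission
  imports Defs
begin

text \<open>
  The proof follows Maurey's proof of Gowers' dichotomy, with ``infinite-dimensional'' replaced by
  ``large''. Two properties of a degree make this possible. Inclusions are morphisms of norm one, so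
  the degree of a finite-dimensional space does not decrease when the surrounding space shrinks
  (\<open>degree_mono\<close>). Moreover, largeness passes to the kernels of finitely many functionals
  (\<open>large_Int_kernel\<close>). Therefore, given large spaces \<open>Z 0 \<supseteq> Z 1 \<supseteq> \<dots>\<close>, one can choose
  finite-dimensional spaces in the \<open>Z n\<close> one after the other, the \<open>n\<close>-th of degree greater than \<open>n\<close> in
  \<open>Z n\<close> and annihilated by functionals that norm the earlier ones. They form an FDD whose partial sum
  projections have norm at most \<open>2\<close>, and these projections transfer the large degrees from the tails to
  the closed span of all blocks, which hence is large and has a better FDD.

  Call a pair \<open>(E, F)\<close> of finite-dimensional spaces accepted by \<open>Z\<close> if for all large \<open>U\<close> and \<open>V\<close>
  in \<open>Z\<close> there are \<open>x \<in> E + U\<close> and \<open>y \<in> F + V\<close> with \<open>norm (x - y) < \<epsilon> * norm (x + y)\<close>. Acceptance is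
  inherited by subspaces, also up to finite codimension, so a diagonal argument yields a large \<open>Z\<close>
  such that every one of countably many pairs is either accepted by \<open>Z\<close> or accepted by no large
  subspace of \<open>Z\<close> (\<open>decides_all\<close>). If \<open>({0}, {0})\<close> is accepted for all \<open>\<epsilon>\<close>, no two large subspaces of
  \<open>Z\<close> form a topological direct sum (\<open>indecomposable_if_accepts\<close>). Otherwise \<open>({0}, {0})\<close> is accepted
  by no large subspace for some \<open>\<epsilon>\<close>. If large \<open>U\<close> and \<open>V\<close> witness that \<open>(E, F)\<close> is not accepted,
  they also witness it for \<open>(E + G, F)\<close> whenever \<open>G \<subseteq> U\<close>. Blocks can therefore be chosen such that
  for every partition of the first \<open>n\<close> of them into two sets the pair of the two spans is not accepted.
  Taking the zero vectors of \<open>U\<close> and \<open>V\<close>, this says that changing signs in a finite sum of vectors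
  from the blocks changes its norm by a factor of at most \<open>1 / \<epsilon>\<close>, and the FDD is unconditional
  (\<open>UFDD_if_not_accepts\<close>).

  The diagonal argument needs countably many finite-dimensional spaces. For this reason all spaces in it are
  spanned by vectors from a countable set \<open>W\<close>, which is closed under the operations that
  the argument uses. Arbitrary closed large subspaces reappear only in the proof of
  indecomposability, where \<open>perturb_into_dense\<close> moves them slightly so that they are spanned by
  vectors from \<open>W\<close>.
\<close>

section \<open>Functionals vanishing on a subspace\<close>

definition sublinear :: "('a::real_vector \<Rightarrow> real) \<Rightarrow> bool" where
  "sublinear q \<longleftrightarrow> (\<forall>x y. q (x + y) \<le> q x + q y) \<and> (\<forall>c\<ge>0. \<forall>x. q (c *\<^sub>R x) = c * q x)"

lemma sublinear_add: "sublinear q \<Longrightarrow> q (x + y) \<le> q x + q y"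
  by (simp add: sublinear_def)

lemma sublinear_scale: "sublinear q \<Longrightarrow> 0 \<le> c \<Longrightarrow> q (c *\<^sub>R x) = c * q x"
  by (simp add: sublinear_def)

lemma sublinear_zero: "sublinear q \<Longrightarrow> q 0 = 0"
  using sublinear_scale[of q 0 0] by simp

lemma sublinear_minus: "sublinear q \<Longrightarrow> - q (- x) \<le> q x"
  using sublinear_add[of q x "- x"] sublinear_zero[of q] by simp

text \<open>For sublinear \<open>q\<close>, this is the largest sublinear functional below \<open>q\<close> whose value at \<open>- v\<close>
  is \<open>- q v\<close>.\<close>

definition steepen :: "('a::real_vector \<Rightarrow> real) \<Rightarrow> 'a \<Rightarrow> 'a \<Rightarrow> real" where
  "steepen q v x = (INF t\<in>{0..}. q (x + t *\<^sub>R v) - t * q v)"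

lemma steepen_le:
  assumes "sublinear q" "0 \<le> t"
  shows "steepen q v x \<le> q (x + t *\<^sub>R v) - t * q v"
  unfolding steepen_def
proof (rule cINF_lower)
  have "- q (- x) \<le> q (x + t *\<^sub>R v) - t * q v" if "0 \<le> t" for t
    using sublinear_add[OF assms(1), of "x + t *\<^sub>R v" "- x"] sublinear_scale[OF assms(1) that]
    by (simp add: algebra_simps)
  then show "bdd_below ((\<lambda>t. q (x + t *\<^sub>R v) - t * q v) ` {0..})"
    by (auto simp: bdd_below_def)
  show "t \<in> {0..}" using assms by simp
qed

lemma steepen_greatest:
  assumes "\<And>t. 0 \<le> t \<Longrightarrow> c \<le> q (x + t *\<^sub>R v) - t * q v"
  shows "c \<le> steepen q v x"
  unfolding steepen_def by (rule cINF_greatest) (use assms in auto)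

lemma sublinear_steepen:
  assumes q: "sublinear q"
  shows "sublinear (steepen q v)"
  unfolding sublinear_def
proof (intro conjI allI impI)
  fix x y
  have 1: "steepen q v (x + y) - (q (y + t *\<^sub>R v) - t * q v) \<le> steepen q v x" if "0 \<le> t" for t
  proof (rule steepen_greatest)
    fix s :: real assume "0 \<le> s"
    then show "steepen q v (x + y) - (q (y + t *\<^sub>R v) - t * q v) \<le> q (x + s *\<^sub>R v) - s * q v"
      using steepen_le[OF q, of "s + t" v "x + y"] that
        sublinear_add[OF q, of "x + s *\<^sub>R v" "y + t *\<^sub>R v"]
      by (simp add: algebra_simps)
  qed
  have "steepen q v (x + y) - steepen q v x \<le> steepen q v y"
    by (rule steepen_greatest) (use 1 in \<open>simp add: algebra_simps\<close>)
  then show "steepen q v (x + y) \<le> steepen q v x + steepen q v y" by simp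
next
  fix c :: real and x assume "0 \<le> c"
  have le: "steepen q v (c *\<^sub>R x) \<le> c * steepen q v x" if "0 < c" for c x
  proof -
    have "steepen q v (c *\<^sub>R x) / c \<le> steepen q v x"
    proof (rule steepen_greatest)
      fix t :: real assume "0 \<le> t"
      have "steepen q v (c *\<^sub>R x) \<le> q (c *\<^sub>R x + (c * t) *\<^sub>R v) - (c * t) * q v"
        using that \<open>0 \<le> t\<close> by (intro steepen_le[OF q]) simp
      also have "c *\<^sub>R x + (c * t) *\<^sub>R v = c *\<^sub>R (x + t *\<^sub>R v)" by (simp add: algebra_simps)
      also have "q (c *\<^sub>R (x + t *\<^sub>R v)) - (c * t) * q v = c * (q (x + t *\<^sub>R v) - t * q v)"
        using sublinear_scale[OF q, of c "x + t *\<^sub>R v"] that by (simp add: right_diff_distrib)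
      finally show "steepen q v (c *\<^sub>R x) / c \<le> q (x + t *\<^sub>R v) - t * q v"
        using that by (simp add: pos_divide_le_eq mult.commute)
    qed
    then show ?thesis using that by (simp add: field_simps)
  qed
  show "steepen q v (c *\<^sub>R x) = c * steepen q v x"
  proof (cases "c = 0")
    case True
    have "steepen q v 0 \<le> 0"
      using steepen_le[OF q, of 0 v 0] sublinear_zero[OF q] by simp
    moreover have "0 \<le> steepen q v 0"
      by (rule steepen_greatest) (simp add: sublinear_scale[OF q])
    ultimately show ?thesis using True by simp
  next
    case False
    then have c: "0 < c" using \<open>0 \<le> c\<close> by simp
    have "steepen q v x \<le> inverse c * steepen q v (c *\<^sub>R x)"
      using le[of "inverse c" "c *\<^sub>R x"] c by simp
    then show ?thesis using le[OF c, of x] c by (simp add: field_simps)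
  qed
qed

text \<open>A sublinear functional minimal below \<open>p\<close> cannot be lowered by \<^term>\<open>steepen\<close>, which forces
  it to be additive. Minimal functionals exist because \<open>- p (- x)\<close> bounds all of them from below.\<close>

lemma linear_below_sublinear:
  fixes p :: "'a::real_vector \<Rightarrow> real"
  assumes p: "sublinear p"
  shows "\<exists>f. linear f \<and> (\<forall>x. f x \<le> p x)"
proof -
  define A where "A = {q. sublinear q \<and> (\<forall>x. q x \<le> p x)}"
  define P where "P = (\<lambda>a b :: 'a \<Rightarrow> real. \<forall>x. b x \<le> a x)"
  have "\<exists>m\<in>A. \<forall>a\<in>A. P m a \<longrightarrow> a = m"
  proof (rule predicate_Zorn)
    show "partial_order_on A (relation_of P A)"
      by (rule partial_order_on_relation_ofI)
         (auto simp: P_def fun_eq_iff intro: order_trans order_antisym)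
    fix C assume C: "C \<in> Chains (relation_of P A)"
    show "\<exists>u\<in>A. \<forall>a\<in>C. P a u"
    proof (cases "C = {}")
      case True then show ?thesis using p by (auto simp: A_def)
    next
      case False
      have CA: "q \<in> A" if "q \<in> C" for q
        using C that by (auto simp: Chains_def relation_of_def)
      have cmp: "P q r \<or> P r q" if "q \<in> C" "r \<in> C" for q r
        using C that by (auto simp: Chains_def relation_of_def)
      define u where "u = (\<lambda>x. INF q\<in>C. q x)"
      have lb: "- p (- x) \<le> q x" if "q \<in> C" for q x
        using CA[OF that] sublinear_minus[of q x] by (auto simp: A_def) (smt (verit))
      have u_le: "u x \<le> q x" if "q \<in> C" for q x
        unfolding u_def by (rule cINF_lower) (use lb that in \<open>auto simp: bdd_below_def\<close>)
      have u_ge: "c \<le> u x" if "\<And>q. q \<in> C \<Longrightarrow> c \<le> q x" for c x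
        unfolding u_def by (rule cINF_greatest) (use that False in auto)
      have "u (x + y) \<le> u x + u y" for x y
      proof -
        have "u (x + y) - r y \<le> u x" if r: "r \<in> C" for r
        proof (rule u_ge)
          fix q assume q: "q \<in> C"
          obtain s where s: "s \<in> C" "s x \<le> q x" "s y \<le> r y"
            using cmp[OF q r] q r by (auto simp: P_def)
          have "u (x + y) \<le> s (x + y)" by (rule u_le[OF s(1)])
          also have "\<dots> \<le> s x + s y" using CA[OF s(1)] by (simp add: A_def sublinear_add)
          finally show "u (x + y) - r y \<le> q x" using s by simp
        qed
        then have "u (x + y) - u x \<le> u y" by (intro u_ge) (simp add: algebra_simps)
        then show ?thesis by simp
      qed
      moreover have "u (c *\<^sub>R x) = c * u x" if "0 \<le> c" for c x
      proof (cases "c = 0")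
        case True
        have "q 0 = 0" if "q \<in> C" for q using CA[OF that] by (simp add: A_def sublinear_zero)
        then have "u 0 = 0" using False u_ge[of 0 0] u_le[of _ 0] by fastforce
        then show ?thesis using True by simp
      next
        case False
        then have c: "0 < c" using that by simp
        have sc: "q (c *\<^sub>R x) = c * q x" if "q \<in> C" for q
          using CA[OF that] c by (simp add: A_def sublinear_scale)
        have "u (c *\<^sub>R x) / c \<le> u x"
        proof (rule u_ge)
          fix q assume "q \<in> C"
          then show "u (c *\<^sub>R x) / c \<le> q x"
            using u_le[of q "c *\<^sub>R x"] c by (simp add: sc field_simps)
        qed
        moreover have "c * u x \<le> u (c *\<^sub>R x)"
        proof (rule u_ge)
          fix q assume "q \<in> C"
          then show "c * u x \<le> q (c *\<^sub>R x)" using u_le[of q x] c by (simp add: sc)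
        qed
        ultimately show ?thesis using c by (simp add: field_simps)
      qed
      ultimately have "sublinear u" by (simp add: sublinear_def)
      moreover have "u x \<le> p x" for x
      proof -
        obtain q where "q \<in> C" using False by auto
        then show ?thesis using u_le[of q x] CA[of q] by (auto simp: A_def intro: order_trans)
      qed
      ultimately show ?thesis using u_le by (auto simp: A_def P_def)
    qed
  qed
  then obtain m where m: "sublinear m" "\<And>x. m x \<le> p x"
    and min: "\<And>a. a \<in> A \<Longrightarrow> P m a \<Longrightarrow> a = m"
    by (auto simp: A_def)
  have "m (x + y) = m x + m y" for x y
  proof -
    have le: "steepen m y z \<le> m z" for z using steepen_le[OF m(1), of 0 y z] by simp
    have "steepen m y = m"
      by (rule min) (use le m sublinear_steepen in \<open>auto simp: A_def P_def intro: order_trans\<close>)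
    then have "m x \<le> m (x + y) - m y" using steepen_le[OF m(1), of 1 y x] by simp
    then show ?thesis using sublinear_add[OF m(1), of x y] by simp
  qed note add = this
  have neg: "m (- x) = - m x" for x using add[of x "- x"] sublinear_zero[OF m(1)] by simp
  have "m (c *\<^sub>R x) = c * m x" for c x
  proof (cases "0 \<le> c")
    case True then show ?thesis by (simp add: sublinear_scale[OF m(1)])
  next
    case False
    then have "m ((- c) *\<^sub>R x) = - c * m x" by (intro sublinear_scale[OF m(1)]) simp
    then show ?thesis using neg[of "c *\<^sub>R x"] by simp
  qed
  then have "linear m" using add by (intro linearI) auto
  then show ?thesis using m by blast
qed

lemma infdist_subspace:
  fixes G :: "'a::real_normed_vector set"
  assumes "subspace G"
  shows "infdist x G \<le> norm x"
  using infdist_le[of 0 G x] subspace_0[OF assms] by simp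

lemma sublinear_infdist:
  fixes G :: "'a::real_normed_vector set"
  assumes G: "subspace G"
  shows "sublinear (\<lambda>x. infdist x G)"
proof -
  have ne: "G \<noteq> {}" using subspace_0[OF G] by auto
  have near: "\<exists>g\<in>G. norm (x - g) < infdist x G + e" if "0 < e" for x e
  proof (rule ccontr)
    assume "\<not> ?thesis"
    then have "infdist x G + e \<le> infdist x G"
      unfolding infdist_notempty[OF ne] by (intro cINF_greatest ne) (auto simp: dist_norm not_less)
    then show False using that by simp
  qed
  show ?thesis unfolding sublinear_def
  proof (intro conjI allI impI)
    fix x y
    show "infdist (x + y) G \<le> infdist x G + infdist y G"
    proof (rule field_le_epsilon)
      fix e :: real assume "0 < e"
      then obtain g h where gh: "g \<in> G" "norm (x - g) < infdist x G + e/2"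
          "h \<in> G" "norm (y - h) < infdist y G + e/2"
        using near[of "e/2" x] near[of "e/2" y] by auto
      have "infdist (x + y) G \<le> norm (x + y - (g + h))"
        using infdist_le[of "g + h" G "x + y"] gh subspace_add[OF G] by (simp add: dist_norm)
      also have "\<dots> \<le> norm (x - g) + norm (y - h)"
        using norm_triangle_ineq[of "x - g" "y - h"] by (simp add: algebra_simps)
      finally show "infdist (x + y) G \<le> infdist x G + infdist y G + e" using gh by simp
    qed
  next
    fix c :: real and x assume "0 \<le> c"
    have le: "infdist (c *\<^sub>R x) G \<le> c * infdist x G" if "0 < c" for c x
    proof (rule field_le_epsilon)
      fix e :: real assume "0 < e"
      then obtain g where g: "g \<in> G" "norm (x - g) < infdist x G + e / c"
        using near[of "e / c" x] \<open>0 < c\<close> by auto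
      have "infdist (c *\<^sub>R x) G \<le> norm (c *\<^sub>R (x - g))"
        using infdist_le[of "c *\<^sub>R g" G "c *\<^sub>R x"] g subspace_scale[OF G]
        by (simp add: dist_norm algebra_simps)
      also have "\<dots> \<le> c * (infdist x G + e / c)" using g \<open>0 < c\<close> by simp
      finally show "infdist (c *\<^sub>R x) G \<le> c * infdist x G + e"
        using \<open>0 < c\<close> by (simp add: distrib_left)
    qed
    show "infdist (c *\<^sub>R x) G = c * infdist x G"
    proof (cases "c = 0")
      case True then show ?thesis using subspace_0[OF G] by simp
    next
      case False
      then have c: "0 < c" using \<open>0 \<le> c\<close> by simp
      show ?thesis using le[OF c, of x] le[of "inverse c" "c *\<^sub>R x"] c by (simp add: field_simps)
    qed
  qed
qed

text \<open>This form of the Hahn--Banach theorem follows from \<open>linear_below_sublinear\<close> applied to the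
  distance to \<open>G\<close>, steepened at \<open>v\<close> so that the value at \<open>v\<close> is attained. For \<open>G = {0}\<close> it gives a
  functional that norms \<open>v\<close>.\<close>

lemma functional_attaining_infdist:
  fixes G :: "'a::real_normed_vector set"
  assumes G: "subspace G"
  shows "\<exists>f :: 'a \<Rightarrow> real. bounded_linear f \<and> (\<forall>x. \<bar>f x\<bar> \<le> norm x) \<and> (\<forall>g\<in>G. f g = 0)
           \<and> f v = infdist v G"
proof -
  let ?p = "\<lambda>x. infdist x G"
  note p = sublinear_infdist[OF G]
  obtain f where f: "linear f" "\<And>x. f x \<le> steepen ?p v x"
    using linear_below_sublinear[OF sublinear_steepen[OF p]] by blast
  have le: "f x \<le> infdist x G" for x
    using f(2)[of x] steepen_le[OF p, of 0 v x] by simp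
  have neg: "f (- x) = - f x" for x using f(1) by (rule linear_neg)
  have "f (- v) \<le> - infdist v G"
    using f(2)[of "- v"] steepen_le[OF p, of 1 v "- v"] subspace_0[OF G] by simp
  then have v: "f v = infdist v G" using le[of v] neg[of v] by simp
  have bd: "\<bar>f x\<bar> \<le> norm x" for x
    using le[of x] le[of "- x"] neg[of x] infdist_subspace[OF G, of x]
      infdist_subspace[OF G, of "- x"] by simp
  have "f g = 0" if "g \<in> G" for g
    using le[of g] le[of "- g"] neg[of g] that subspace_neg[OF G that] by simp
  moreover have "bounded_linear f"
    by (rule bounded_linear_intro[where K = 1]) (use f(1) bd in \<open>auto simp: linear_add linear_scale\<close>)
  ultimately show ?thesis using bd v by blast
qed

section \<open>Finite-dimensional subspaces\<close>

lemma fin_dim_basis: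
  assumes "subspace V" "fin_dim V"
  obtains B where "finite B" "B \<subseteq> V" "span B = V"
proof -
  obtain B where B: "B \<subseteq> V" "independent B" "V \<subseteq> span B"
    using maximal_independent_subset by blast
  obtain T where "finite T" "V \<subseteq> span T" using assms(2) by (auto simp: fin_dim_def)
  then have "finite B" using independent_span_bound[of T B] B by auto
  moreover have "span B = V" using B span_minimal[OF B(1) assms(1)] by auto
  ultimately show thesis using that B by blast
qed

lemma fin_dim_span: "finite B \<Longrightarrow> fin_dim (span B)"
  by (auto simp: fin_dim_def)



text \<open>A convergent sequence is bounded and so stays in one of the compact sets.\<close>

lemma closed_if_compact_balls:
  fixes V :: "'a::real_normed_vector set"
  assumes "\<And>r. compact {x\<in>V. norm x \<le> r}"
  shows "closed V"
  unfolding closed_sequential_limits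
proof (intro allI impI)
  fix x l assume x: "(\<forall>n. x n \<in> V) \<and> x \<longlonglongrightarrow> l"
  then have "bounded (range x)" using convergent_imp_bounded by blast
  then obtain r where "\<And>n. norm (x n) \<le> r" by (auto simp: bounded_iff)
  then have "\<forall>n. x n \<in> {x\<in>V. norm x \<le> r}" using x by auto
  then have "l \<in> {x\<in>V. norm x \<le> r}"
    using closed_sequentially[OF compact_imp_closed[OF assms]] x by blast
  then show "l \<in> V" by simp
qed

text \<open>A functional that vanishes on \<open>span B\<close> and is nonzero at \<open>b\<close> bounds the coefficient of \<open>b\<close>, so
  the ball of the larger span lies in the image of a compact product.\<close>

lemma compact_span_finite:
  fixes B :: "'a::real_normed_vector set"
  assumes "finite B"
  shows "compact {x\<in>span B. norm x \<le> r}"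
  using assms
proof (induction B arbitrary: r)
  case empty
  have "{x\<in>span {}. norm x \<le> r} = (if 0 \<le> r then {0::'a} else {})" by auto
  then show ?case by auto
next
  case (insert b B)
  show ?case
  proof (cases "b \<in> span B")
    case True
    then show ?thesis using insert.IH by (simp add: span_redundant)
  next
    case False
    have "closed (span B)" using insert.IH by (rule closed_if_compact_balls)
    moreover have "span B \<noteq> {}" using span_zero by blast
    ultimately have pos: "0 < infdist b (span B)"
      using False infdist_pos_not_in_closed by blast
    obtain f :: "'a \<Rightarrow> real" where f: "bounded_linear f" "\<And>x. \<bar>f x\<bar> \<le> norm x"
        "\<And>g. g \<in> span B \<Longrightarrow> f g = 0" "f b = infdist b (span B)"
      using functional_attaining_infdist[OF subspace_span, of B b] by blast
    interpret f: bounded_linear f by fact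
    define c where "c = r / f b"
    define C where "C = {x\<in>span B. norm x \<le> r + c * norm b}"
    define h where "h = (\<lambda>z. fst z *\<^sub>R b + snd z)"
    have fb: "0 < f b" using pos f by simp
    have "{x\<in>span (insert b B). norm x \<le> r} = cball 0 r \<inter> h ` ({-c..c} \<times> C)"
    proof (intro set_eqI iffI)
      fix x assume x: "x \<in> {x\<in>span (insert b B). norm x \<le> r}"
      then obtain k where k: "x - k *\<^sub>R b \<in> span B" by (auto simp: span_insert)
      have "f x = k * f b" using f(3)[OF k] by (simp add: f.diff f.scaleR)
      then have "\<bar>k\<bar> * f b \<le> r" using f(2)[of x] x fb by (simp add: abs_mult)
      then have kc: "\<bar>k\<bar> \<le> c" using fb by (simp add: c_def pos_le_divide_eq)
      have "norm (x - k *\<^sub>R b) \<le> norm x + \<bar>k\<bar> * norm b"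
        using norm_triangle_ineq4[of x "k *\<^sub>R b"] by simp
      also have "\<dots> \<le> r + c * norm b" using x kc by (intro add_mono mult_right_mono) auto
      finally have "(k, x - k *\<^sub>R b) \<in> {-c..c} \<times> C" using k kc by (auto simp: C_def)
      moreover have "x = h (k, x - k *\<^sub>R b)" by (simp add: h_def)
      ultimately show "x \<in> cball 0 r \<inter> h ` ({-c..c} \<times> C)" using x by auto
    next
      fix x assume "x \<in> cball 0 r \<inter> h ` ({-c..c} \<times> C)"
      then obtain k y where "norm x \<le> r" "y \<in> span B" "x = k *\<^sub>R b + y"
        by (auto simp: C_def h_def)
      moreover have "y \<in> span (insert b B)"
        using \<open>y \<in> span B\<close> span_mono[of B "insert b B"] by blast
      ultimately show "x \<in> {x\<in>span (insert b B). norm x \<le> r}"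
        using span_add[OF span_scale[OF span_base[of b "insert b B"]]] by simp
    qed
    moreover have "compact (h ` ({-c..c} \<times> C))"
      by (intro compact_continuous_image compact_Times)
         (auto simp: h_def C_def intro!: insert.IH continuous_intros)
    ultimately show ?thesis by (simp add: closed_Int_compact)
  qed
qed

lemma closed_span_finite:
  fixes B :: "'a::real_normed_vector set"
  shows "finite B \<Longrightarrow> closed (span B)"
  using compact_span_finite by (rule closed_if_compact_balls)

definition norming :: "'a::real_normed_vector set \<Rightarrow> ('a \<Rightarrow> real) set \<Rightarrow> bool" where
  "norming t \<Phi> \<longleftrightarrow> finite \<Phi> \<and> (\<forall>f\<in>\<Phi>. bounded_linear f \<and> (\<forall>x. \<bar>f x\<bar> \<le> norm x)) \<and>
     (\<forall>h\<in>span t. \<exists>f\<in>\<Phi>. norm h \<le> 2 * \<bar>f h\<bar>)"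

text \<open>Functionals norming the points of a finite net of the unit ball, which is compact, norm the
  whole finite-dimensional space up to the factor \<open>2\<close>.\<close>

lemma norming_exists:
  fixes t :: "'a::real_normed_vector set"
  assumes "finite t"
  shows "\<exists>\<Phi>. norming t \<Phi>"
proof -
  obtain k where k: "finite k" "{x\<in>span t. norm x \<le> 1} \<subseteq> (\<Union>x\<in>k. ball x (1/4))"
    using compact_span_finite[OF assms, of 1] compact_eq_totally_bounded[of "{x\<in>span t. norm x \<le> 1}"]
    by (meson zero_less_divide_1_iff zero_less_numeral)
  have "\<exists>f. bounded_linear f \<and> (\<forall>x. \<bar>f x\<bar> \<le> norm x) \<and> f v = norm v" for v :: 'a
    using functional_attaining_infdist[OF subspace_single_0, of v] by auto
  then obtain N where N: "\<And>v::'a. bounded_linear (N v)" "\<And>v x. \<bar>N v x\<bar> \<le> norm x"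
      "\<And>v. N v v = norm v"
    by metis
  have half: "\<exists>v\<in>k. 1 \<le> 2 * \<bar>N v h\<bar>" if h: "h \<in> span t" "norm h = 1" for h
  proof -
    obtain v where v: "v \<in> k" "norm (v - h) < 1/4" using k h by (auto simp: dist_norm)
    have "norm v - N v h = N v (v - h)" by (simp add: N bounded_linear.linear[THEN linear_diff])
    then have "norm v - N v h \<le> 1/4" using N(2)[of v "v - h"] v by simp
    moreover have "3/4 \<le> norm v" using norm_triangle_ineq3[of v h] v h by simp
    ultimately show ?thesis using v by (intro bexI[of _ v]) auto
  qed
  have "\<exists>v\<in>insert 0 k. norm h \<le> 2 * \<bar>N v h\<bar>" if h: "h \<in> span t" for h
  proof (cases "h = 0")
    case False
    then obtain v where v: "v \<in> k" "1 \<le> 2 * \<bar>N v ((1 / norm h) *\<^sub>R h)\<bar>"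
      using half[of "(1 / norm h) *\<^sub>R h"] h by (auto simp: span_scale)
    have "N v ((1 / norm h) *\<^sub>R h) = N v h / norm h"
      using linear_scale[OF bounded_linear.linear[OF N(1)], of v "1 / norm h" h] by simp
    then have "1 \<le> 2 * \<bar>N v h\<bar> / norm h" using v by simp
    then have "norm h \<le> 2 * \<bar>N v h\<bar>" using False by (simp add: pos_le_divide_eq)
    then show ?thesis using v by blast
  qed auto
  then have "norming t (N ` insert 0 k)" using k N by (auto simp: norming_def)
  then show ?thesis by blast
qed

text \<open>The common kernel of a norming set is separated from the normed space, as in Mazur's
  construction of basic sequences.\<close>

lemma norming_separates:
  assumes "norming t \<Phi>" "h \<in> span t" "\<And>f. f \<in> \<Phi> \<Longrightarrow> f w = 0"
  shows "norm h \<le> 2 * norm (h + w)"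
proof -
  obtain f where f: "f \<in> \<Phi>" "norm h \<le> 2 * \<bar>f h\<bar>" "bounded_linear f" "\<And>x. \<bar>f x\<bar> \<le> norm x"
    using assms by (auto simp: norming_def)
  have "f (h + w) = f h" using assms(3)[OF f(1)] f(3) by (simp add: bounded_linear.linear linear_add)
  then show ?thesis using f(2) f(4)[of "h + w"] by simp
qed

text \<open>Riesz's lemma, scaled such that the distance to the finite-dimensional space is \<open>1\<close>.\<close>

lemma riesz_unit_distance:
  fixes U :: "'a::real_normed_vector set"
  assumes U: "subspace U" and B: "finite B" "span B \<subseteq> U" and ne: "\<not> U \<subseteq> span B"
  obtains e where "e \<in> U" "infdist e (span B) = 1" "norm e \<le> 2"
proof -
  obtain x where x: "x \<in> U" "x \<notin> span B" using ne by auto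
  have sne: "span B \<noteq> {}" using span_zero by blast
  define r where "r = infdist x (span B)"
  have r: "0 < r"
    unfolding r_def using infdist_pos_not_in_closed[OF closed_span_finite[OF B(1)] sne x(2)] .
  have "\<exists>h\<in>span B. dist x h < 2 * r"
  proof (rule ccontr)
    assume "\<not> ?thesis"
    then have "2 * r \<le> r" unfolding r_def infdist_notempty[OF sne]
      by (intro cINF_greatest sne) (auto simp: not_less)
    then show False using r by simp
  qed
  then obtain h where h: "h \<in> span B" "norm (x - h) < 2 * r" by (auto simp: dist_norm)
  note sl = sublinear_infdist[OF subspace_span, of B]
  have "infdist (x - h) (span B) = r"
    using sublinear_add[OF sl, of "x - h" h] sublinear_add[OF sl, of x "- h"] h span_neg[OF h(1)]
    by (simp add: r_def)
  then have "infdist ((1/r) *\<^sub>R (x - h)) (span B) = 1"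
    using sublinear_scale[OF sl, of "1/r" "x - h"] r by simp
  moreover have "norm ((1/r) *\<^sub>R (x - h)) \<le> 2"
    using h r by (simp add: pos_divide_le_eq del: scaleR_right_diff_distrib)
  moreover have "(1/r) *\<^sub>R (x - h) \<in> U"
    using x h B U by (auto intro!: subspace_scale subspace_diff)
  ultimately show thesis using that by blast
qed

lemma subspace_closure:
  fixes U :: "'a::real_normed_vector set"
  assumes U: "subspace U"
  shows "subspace (closure U)"
proof (rule subspaceI)
  show "0 \<in> closure U" using subspace_0[OF U] closure_subset by blast
  fix x y c assume x: "x \<in> closure U"
  then obtain a where a: "\<forall>n. a n \<in> U" "a \<longlonglongrightarrow> x" by (auto simp: closure_sequential)
  then have "\<forall>n. c *\<^sub>R a n \<in> U" "(\<lambda>n. c *\<^sub>R a n) \<longlonglongrightarrow> c *\<^sub>R x"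
    by (auto intro: subspace_scale[OF U] tendsto_intros)
  then show "c *\<^sub>R x \<in> closure U" by (auto simp: closure_sequential)
  assume "y \<in> closure U"
  then obtain b where b: "\<forall>n. b n \<in> U" "b \<longlonglongrightarrow> y" by (auto simp: closure_sequential)
  have "\<forall>n. a n + b n \<in> U" "(\<lambda>n. a n + b n) \<longlonglongrightarrow> x + y"
    using a b by (auto intro: subspace_add[OF U] tendsto_intros)
  then show "x + y \<in> closure U" unfolding closure_sequential by (intro exI[of _ "\<lambda>n. a n + b n"]) auto
qed

section \<open>Degrees and large subspaces\<close>

locale degree =
  fixes d :: "'a::banach set \<Rightarrow> ('a \<Rightarrow> real) \<Rightarrow> 'a set \<Rightarrow> real" and K :: "real \<Rightarrow> real \<Rightarrow> real"
  assumes nonneg: "approx_pair V N F \<Longrightarrow> 0 \<le> d V N F"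
    and K_mono: "1 \<le> s \<Longrightarrow> s \<le> s' \<Longrightarrow> 0 \<le> t \<Longrightarrow> t \<le> t' \<Longrightarrow> K s t \<le> K s' t'"
    and K_lim: "0 \<le> t \<Longrightarrow> ((\<lambda>s. K s t) \<longlongrightarrow> t) (at_right 1)"
    and functorial: "approx_pair V N F \<Longrightarrow> approx_pair W M G \<Longrightarrow> morphism V N F W M G S T \<Longrightarrow>
      d W M G \<le> K (morphism_norm V N M G S T) (d V N F)"
begin

lemma K_1_le:
  assumes "0 \<le> t"
  shows "K 1 t \<le> t"
proof (rule tendsto_lowerbound[OF K_lim[OF assms]])
  show "\<forall>\<^sub>F s in at_right 1. K 1 t \<le> K s t"
    using K_mono[of 1 _ t t] assms by (auto simp: eventually_at_right_field intro!: exI[of _ 2])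
qed simp

lemma approx_pair_span:
  "subspace V \<Longrightarrow> closed V \<Longrightarrow> finite B \<Longrightarrow> B \<subseteq> V \<Longrightarrow> approx_pair (V :: 'a set) norm (span B)"
  by (simp add: approx_pair_def banach_on_norm fin_dim_span span_minimal)

text \<open>A morphism with \<open>G \<noteq> {0}\<close> has norm at least \<open>1\<close>, so monotonicity of \<open>K\<close> in its first argument
  allows the norm to be replaced by any upper bound.\<close>

lemma degree_le:
  assumes V: "subspace V" "closed V" "finite A" "A \<subseteq> V"
    and W: "subspace W" "closed W" "finite B" "B \<subseteq> W"
    and S: "linear S" "\<And>x. x \<in> B \<Longrightarrow> S x \<in> span A" "\<And>x. norm (S x) \<le> a * norm x"
    and T: "\<And>x. x \<in> V \<Longrightarrow> T x \<in> W" "\<And>x y. x \<in> V \<Longrightarrow> y \<in> V \<Longrightarrow> T (x + y) = T x + T y"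
      "\<And>c x. x \<in> V \<Longrightarrow> T (c *\<^sub>R x) = c *\<^sub>R T x" "\<And>x. x \<in> V \<Longrightarrow> norm (T x) \<le> b * norm x"
    and TS: "\<And>x. x \<in> span B \<Longrightarrow> T (S x) = x"
    and c: "0 \<le> a" "0 \<le> b" "1 \<le> c" "a * b \<le> c"
  shows "d W norm (span B) \<le> K c (d V norm (span A))"
proof -
  note pV = approx_pair_span[OF V] and pW = approx_pair_span[OF W]
  have SB: "S x \<in> span A" if "x \<in> span B" for x
    using that
  proof (induction rule: span_induct_alt)
    case base then show ?case using linear_0[OF S(1)] by (simp add: span_zero)
  next
    case (step k x y)
    then show ?case using S by (simp add: linear_add linear_scale span_add span_scale)
  qed
  have AV: "span A \<subseteq> V" using span_minimal V by blast
  have mor: "morphism V norm (span A) W norm (span B) S T"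
    unfolding morphism_def bounded_op_def
    using S T(1-3) SB TS by (auto simp: linear_add linear_scale intro: T(4))
  let ?oS = "op_norm (span B) norm norm S" and ?oT = "op_norm V norm norm T"
  have leS: "norm (S x) \<le> a" if "norm x \<le> 1" for x
    using S(3)[of x] mult_left_mono[OF that c(1)] by simp
  have leT: "norm (T x) \<le> b" if "x \<in> V" "norm x \<le> 1" for x
    using T(4)[OF that(1)] mult_left_mono[OF that(2) c(2)] by simp
  have "?oS \<le> a" unfolding op_norm_def
    by (rule cSUP_least) (use leS in \<open>auto intro!: exI[of _ 0] simp: span_zero\<close>)
  moreover have "?oT \<le> b" unfolding op_norm_def
    by (rule cSUP_least) (use leT subspace_0[OF V(1)] in \<open>auto intro!: exI[of _ 0]\<close>)
  moreover have upS: "norm (S x) \<le> ?oS" if "x \<in> span B" "norm x \<le> 1" for x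
    unfolding op_norm_def
    by (rule cSUP_upper) (use that leS in \<open>auto simp: bdd_above_def\<close>)
  moreover have upT: "norm (T x) \<le> ?oT" if "x \<in> V" "norm x \<le> 1" for x
    unfolding op_norm_def
    by (rule cSUP_upper) (use that leT in \<open>auto simp: bdd_above_def\<close>)
  moreover have "0 \<le> ?oS" using upS[of 0] linear_0[OF S(1)] by (simp add: span_zero)
  moreover have "0 \<le> ?oT" using order_trans[OF norm_ge_zero upT[of 0]] subspace_0[OF V(1)] by simp
  ultimately have "?oS * ?oT \<le> a * b" by (intro mult_mono) auto
  then have up: "morphism_norm V norm norm (span B) S T \<le> c"
    using c by (simp add: morphism_norm_def)
  have "1 \<le> morphism_norm V norm norm (span B) S T"
  proof (cases "span B = {0}")
    case False
    then obtain g where g: "g \<in> span B" "g \<noteq> 0" using span_zero[of B] by blast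
    define u where "u = (1 / norm g) *\<^sub>R g"
    have u: "u \<in> span B" "norm u = 1" using g by (auto simp: u_def span_scale)
    have SuV: "S u \<in> V" using SB[OF u(1)] AV by blast
    have ne: "S u \<noteq> 0"
    proof
      assume "S u = 0"
      then have "u = T (0 *\<^sub>R S u)" using TS[OF u(1)] by simp
      also have "\<dots> = 0" using T(3)[OF SuV, of 0] by simp
      finally show False using u by simp
    qed
    have "1 = norm (T (norm (S u) *\<^sub>R ((1 / norm (S u)) *\<^sub>R S u)))"
      using ne TS[OF u(1)] u by simp
    also have "\<dots> = norm (S u) * norm (T ((1 / norm (S u)) *\<^sub>R S u))"
      by (subst T(3)) (auto intro: subspace_scale[OF V(1)] SuV)
    also have "\<dots> \<le> ?oS * ?oT"
      using ne u by (intro mult_mono upS upT) (auto intro: subspace_scale[OF V(1)] SuV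
          order_trans[OF norm_ge_zero upS])
    finally show ?thesis using False by (simp add: morphism_norm_def)
  qed (simp add: morphism_norm_def)
  then have "K (morphism_norm V norm norm (span B) S T) (d V norm (span A)) \<le> K c (d V norm (span A))"
    using nonneg[OF pV] up by (intro K_mono) auto
  then show ?thesis using functorial[OF pV pW mor] by simp
qed

text \<open>Both inclusions are operators of norm \<open>1\<close>, and \<open>K 1 t \<le> t\<close> since \<open>K s t\<close> tends to \<open>t\<close>. Hence
  degrees grow when the surrounding space shrinks or the finite-dimensional space grows.\<close>

lemma degree_mono:
  assumes "subspace V" "closed V" "subspace W" "closed W" "V \<subseteq> W"
    and "finite A" "A \<subseteq> V" "finite B" "B \<subseteq> span A"
  shows "d W norm (span B) \<le> d V norm (span A)"
proof -
  have "span A \<subseteq> V" using assms span_minimal by blast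
  then have "d W norm (span B) \<le> K 1 (d V norm (span A))"
    by (intro degree_le[where S = "\<lambda>x. x" and T = "\<lambda>x. x" and a = 1 and b = 1])
       (use assms linear_id[unfolded id_def] in auto)
  also have "\<dots> \<le> d V norm (span A)"
    using assms by (intro K_1_le nonneg approx_pair_span)
  finally show ?thesis .
qed

text \<open>The subspace \<open>U\<close> need not be closed. Its degrees are taken in the closure, which is a Banach
  space, but the finite-dimensional subspaces are taken from \<open>U\<close> itself, so that in the span of a
  countable set they can be spanned by elements of that set.\<close>

definition large :: "'a set \<Rightarrow> bool" where
  "large U \<longleftrightarrow> (\<forall>M. \<exists>B. finite B \<and> B \<subseteq> U \<and> M < d (closure U) norm (span B))"

lemma d_large_iff_large:
  assumes "subspace V" "closed V"
  shows "d_large d V norm \<longleftrightarrow> large V"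
proof
  assume l: "d_large d V norm"
  show "large V" unfolding large_def
  proof
    fix M
    obtain F where F: "subspace F" "F \<subseteq> V" "fin_dim F" "M < d V norm F"
      using l unfolding d_small_def bdd_above_def by (auto simp: not_le)
    then obtain B where "finite B" "B \<subseteq> F" "span B = F" using fin_dim_basis by blast
    then show "\<exists>B. finite B \<and> B \<subseteq> V \<and> M < d (closure V) norm (span B)"
      using F assms by (intro exI[of _ B]) (auto simp: closure_closed)
  qed
next
  assume l: "large V"
  show "d_large d V norm"
  proof
    assume "d_small d V norm"
    then obtain M where M: "\<And>F. subspace F \<Longrightarrow> F \<subseteq> V \<Longrightarrow> fin_dim F \<Longrightarrow> d V norm F \<le> M"
      unfolding d_small_def bdd_above_def by auto
    obtain B where "finite B" "B \<subseteq> V" "M < d V norm (span B)"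
      using l assms unfolding large_def by (auto simp: closure_closed)
    then show False
      using M[of "span B"] assms by (simp add: span_minimal fin_dim_span)
  qed
qed

lemma large_subset:
  assumes "subspace U" "U \<subseteq> V" "subspace V" "closed V"
    and "\<And>M. \<exists>B. finite B \<and> B \<subseteq> U \<and> M < d V norm (span B)"
  shows "large U"
  unfolding large_def
proof
  fix M
  obtain B where B: "finite B" "B \<subseteq> U" "M < d V norm (span B)" using assms(5) by blast
  have "d V norm (span B) \<le> d (closure U) norm (span B)"
    using assms B closure_subset[of U] closure_minimal[of U V]
    by (intro degree_mono) (auto simp: subspace_closure span_base)
  then show "\<exists>B. finite B \<and> B \<subseteq> U \<and> M < d (closure U) norm (span B)"
    using B by (intro exI[of _ B]) auto
qed

lemma large_closure: "subspace U \<Longrightarrow> large U \<Longrightarrow> large (closure U)"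
  unfolding large_def using closure_subset[of U] by (auto, meson order_trans)

lemma large_not_fin_dim:
  assumes "subspace U" "large U"
  shows "\<not> fin_dim U"
proof
  assume "fin_dim U"
  then obtain B where B: "finite B" "B \<subseteq> U" "span B = U" using fin_dim_basis assms by blast
  then have cl: "closed U" using closed_span_finite[of B] by simp
  obtain A where "finite A" "A \<subseteq> U" "d U norm (span B) < d (closure U) norm (span A)"
    using assms unfolding large_def by blast
  moreover have "d U norm (span A) \<le> d U norm (span B)"
    using assms cl B \<open>finite A\<close> \<open>A \<subseteq> U\<close> by (intro degree_mono) auto
  ultimately show False using cl by (simp add: closure_closed)
qed

text \<open>Largeness survives passing to the kernel \<open>U0\<close> of a functional on \<open>U = U0 + \<real> v\<close>. Given a
  finite-dimensional subspace of \<open>U\<close>, contained in \<open>F0 + \<real> v\<close> with \<open>F0 \<subseteq> U0\<close>, there is \<open>e \<in> U0\<close> far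
  from \<open>F0\<close>, and \<open>F0 + \<real> e\<close> can play the role of \<open>F0 + \<real> v\<close>: a functional that vanishes on \<open>F0\<close>
  and is \<open>1\<close> at \<open>e\<close> provides an operator \<open>U0 \<rightarrow> U\<close> which is the identity on \<open>F0\<close> and maps \<open>e\<close> to \<open>v\<close>.
  The norms do not depend on \<open>F0\<close>.\<close>

lemma large_Int_kernel:
  assumes U: "subspace U" and l: "large U" and \<phi>: "bounded_linear \<phi>"
  shows "large (U \<inter> {x. \<phi> x = (0::real)})"
proof (cases "U \<subseteq> {x. \<phi> x = 0}")
  case True then show ?thesis using l by (simp add: Int_absorb2)
next
  case False
  interpret \<phi>: bounded_linear \<phi> by fact
  define U0 where "U0 = U \<inter> {x. \<phi> x = 0}"
  have U0: "subspace U0"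
    unfolding U0_def by (intro subspace_inter U) (auto simp: subspace_def \<phi>.add \<phi>.scaleR)
  obtain v' where v': "v' \<in> U" "\<phi> v' \<noteq> 0" using False by auto
  define v where "v = (1 / \<phi> v') *\<^sub>R v'"
  have v: "v \<in> U" "\<phi> v = 1" using v' U by (auto simp: v_def \<phi>.scaleR subspace_scale)
  obtain C where C: "0 < C" "\<And>x. \<bar>\<phi> x\<bar> \<le> norm x * C" using \<phi>.pos_bounded by auto
  \<comment> \<open>so that there is room in \<open>U0\<close> for the vector \<open>e\<close>\<close>
  have nfd: "\<not> fin_dim U0"
  proof
    assume "fin_dim U0"
    then obtain B where B: "finite B" "U0 \<subseteq> span B" by (auto simp: fin_dim_def)
    have "U \<subseteq> span (insert v B)"
    proof
      fix x assume "x \<in> U"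
      then have "x - \<phi> x *\<^sub>R v \<in> U0"
        using v U by (auto simp: U0_def \<phi>.diff \<phi>.scaleR subspace_diff subspace_scale)
      then show "x \<in> span (insert v B)" using B by (auto simp: span_insert)
    qed
    then have "fin_dim U" using B by (auto simp: fin_dim_def)
    then show False using large_not_fin_dim U l by blast
  qed
  \<comment> \<open>bounds \<open>norm S * norm T\<close> for the operators below, since \<open>norm (e - v) \<le> norm v + 2\<close>\<close>
  define c where "c = (1 + C * (norm v + 2)) * (1 + (norm v + 2))"
  have "large U0" unfolding large_def
  proof (rule ccontr)
    assume "\<not> (\<forall>M. \<exists>B. finite B \<and> B \<subseteq> U0 \<and> M < d (closure U0) norm (span B))"
    then obtain M where M: "\<And>B. finite B \<Longrightarrow> B \<subseteq> U0 \<Longrightarrow> d (closure U0) norm (span B) \<le> M"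
      by (auto simp: not_less)
    have "d (closure U) norm (span B) \<le> K c M" if B: "finite B" "B \<subseteq> U" for B
    proof -
      define B0 where "B0 = (\<lambda>x. x - \<phi> x *\<^sub>R v) ` B"
      have B0: "finite B0" "B0 \<subseteq> U0"
        using B v U by (auto simp: B0_def U0_def \<phi>.diff \<phi>.scaleR subspace_diff subspace_scale subset_iff)
      have "\<not> U0 \<subseteq> span B0" using nfd B0 by (auto simp: fin_dim_def)
      then obtain e where e: "e \<in> U0" "infdist e (span B0) = 1" "norm e \<le> 2"
        using riesz_unit_distance[OF U0 B0(1)] B0 span_minimal[OF _ U0] by blast
      obtain f :: "'a \<Rightarrow> real" where f: "bounded_linear f" "\<And>x. \<bar>f x\<bar> \<le> norm x"
          "\<And>g. g \<in> span B0 \<Longrightarrow> f g = 0" "f e = 1"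
        using functional_attaining_infdist[OF subspace_span, of B0 e] e by auto
      interpret f: bounded_linear f by fact
      \<comment> \<open>\<open>S\<close> exchanges \<open>v\<close> for \<open>e\<close> in \<open>F0 + \<real> v\<close>, and \<open>T\<close> exchanges it back.\<close>
      define S where "S = (\<lambda>x. x + \<phi> x *\<^sub>R (e - v))"
      define T where "T = (\<lambda>x. x + f x *\<^sub>R (v - e))"
      have ev: "norm (e - v) \<le> norm v + 2" "norm (v - e) \<le> norm v + 2"
        using e norm_triangle_ineq4[of e v] norm_triangle_ineq4[of v e] by auto
      have S_fB: "\<phi> x = f (S x)" if "x \<in> span B" for x
      proof -
        have "f (x - \<phi> x *\<^sub>R v) = 0"
        proof (rule f(3))
          show "x - \<phi> x *\<^sub>R v \<in> span B0" using that
          proof (induction rule: span_induct_alt)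
            case (step c x y)
            have "c *\<^sub>R x + y - \<phi> (c *\<^sub>R x + y) *\<^sub>R v = c *\<^sub>R (x - \<phi> x *\<^sub>R v) + (y - \<phi> y *\<^sub>R v)"
              by (simp add: \<phi>.add \<phi>.scaleR algebra_simps)
            moreover have "x - \<phi> x *\<^sub>R v \<in> span B0"
              using step by (intro span_base) (auto simp: B0_def)
            ultimately show ?case using step by (simp only: span_add span_scale)
          qed (simp add: span_zero \<phi>.zero)
        qed
        then show ?thesis by (simp add: S_def f.add f.diff f.scaleR f(4) algebra_simps)
      qed
      have sub: "B \<subseteq> closure U" "insert e B0 \<subseteq> closure U0"
        using B B0 e closure_subset[of U] closure_subset[of U0] by blast+
      have "d (closure U) norm (span B) \<le> K c (d (closure U0) norm (span (insert e B0)))"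
      proof (rule degree_le[where S = S and T = T and a = "1 + C * (norm v + 2)" and b = "1 + (norm v + 2)"])
        show "linear S" by (rule linearI) (auto simp: S_def \<phi>.add \<phi>.scaleR algebra_simps)
        show "S x \<in> span (insert e B0)" if "x \<in> B" for x
        proof -
          have "S x = (x - \<phi> x *\<^sub>R v) + \<phi> x *\<^sub>R e" by (simp add: S_def algebra_simps)
          moreover have "x - \<phi> x *\<^sub>R v \<in> span (insert e B0)"
            using that by (intro span_base) (auto simp: B0_def)
          ultimately show ?thesis by (simp add: span_add span_scale span_base)
        qed
        show "norm (S x) \<le> (1 + C * (norm v + 2)) * norm x" for x
        proof -
          have "norm (S x) \<le> norm x + \<bar>\<phi> x\<bar> * norm (e - v)"
            unfolding S_def using norm_triangle_ineq[of x "\<phi> x *\<^sub>R (e - v)"] by simp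
          also have "\<dots> \<le> norm x + (norm x * C) * (norm v + 2)"
            using C ev by (intro add_left_mono mult_mono) auto
          finally show ?thesis by (simp add: algebra_simps)
        qed
        have cl: "v - e \<in> closure U"
          using v e U closure_subset[of U] by (auto simp: U0_def intro: subspace_diff)
        show "T x \<in> closure U" if "x \<in> closure U0" for x
          unfolding T_def using that cl closure_mono[of U0 U]
          by (intro subspace_add subspace_scale subspace_closure U) (auto simp: U0_def)
        show "norm (T x) \<le> (1 + (norm v + 2)) * norm x" for x
        proof -
          have "norm (T x) \<le> norm x + \<bar>f x\<bar> * norm (v - e)"
            unfolding T_def using norm_triangle_ineq[of x "f x *\<^sub>R (v - e)"] by simp
          also have "\<dots> \<le> norm x + norm x * (norm v + 2)"
            using f(2) ev by (intro add_left_mono mult_mono) auto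
          finally show ?thesis by (simp add: algebra_simps)
        qed
        show "T (S x) = x" if "x \<in> span B" for x
        proof -
          have "T (S x) = S x + \<phi> x *\<^sub>R (v - e)" using S_fB[OF that] by (simp add: T_def)
          then show ?thesis by (simp add: S_def algebra_simps)
        qed
        show "1 \<le> c"
          unfolding c_def using C mult_mono[of 1 "1 + C * (norm v + 2)" 1 "1 + (norm v + 2)"] by simp
      qed (use B B0 U U0 C sub in
            \<open>auto simp: c_def T_def f.add f.scaleR algebra_simps subspace_closure\<close>)
      also have "\<dots> \<le> K c M"
      proof (rule K_mono)
        show "1 \<le> c"
          unfolding c_def using C mult_mono[of 1 "1 + C * (norm v + 2)" 1 "1 + (norm v + 2)"] by simp
        show "0 \<le> d (closure U0) norm (span (insert e B0))"
          using B0 e U0 closure_subset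
          by (intro nonneg approx_pair_span) (auto simp: subspace_closure)
        show "d (closure U0) norm (span (insert e B0)) \<le> M" using M B0 e by simp
      qed simp
      finally show ?thesis .
    qed
    then show False using l unfolding large_def by (meson not_le)
  qed
  then show ?thesis by (simp add: U0_def)
qed

lemma large_Int_kernels:
  assumes U: "subspace U" "large U" and \<Phi>: "finite \<Phi>" "\<And>f. f \<in> \<Phi> \<Longrightarrow> bounded_linear f"
  shows "large (U \<inter> {x. \<forall>f\<in>\<Phi>. f x = (0::real)})"
  using \<Phi>
proof (induction \<Phi>)
  case empty then show ?case using U by simp
next
  case (insert f \<Phi>)
  have "subspace {x. \<forall>f\<in>\<Phi>. f x = 0}"
    using insert.prems by (auto simp: subspace_def bounded_linear.linear linear_0 linear_add linear_scale)
  then have "large ((U \<inter> {x. \<forall>f\<in>\<Phi>. f x = 0}) \<inter> {x. f x = 0})"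
    using insert U by (intro large_Int_kernel subspace_inter) auto
  moreover have "(U \<inter> {x. \<forall>f\<in>\<Phi>. f x = 0}) \<inter> {x. f x = 0} = U \<inter> {x. \<forall>f\<in>insert f \<Phi>. f x = 0}"
    by auto
  ultimately show ?case by simp
qed

end

section \<open>Perturbing a large subspace into a dense set\<close>

context degree
begin

text \<open>A triangular system is enough: if \<open>\<psi> n\<close> vanishes on the span of \<open>e 0, \<dots>, e (n - 1)\<close> and is
  \<open>1\<close> at \<open>e n\<close>, then the value of \<open>R x = x + (\<Sum>n. \<psi> n x *\<^sub>R \<delta> n)\<close> at \<open>e n\<close> depends on
  \<open>\<delta> 0, \<dots>, \<delta> n\<close> only, so the \<open>\<delta> n\<close> can be chosen in turn, as small as desired, such that each
  \<open>R (e n)\<close> falls into the dense set. Being close to the identity, \<open>R\<close> is an isomorphism onto its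
  range and transports largeness.\<close>

lemma perturb_into_dense:
  assumes A: "subspace A" "closed A" "large A"
    and D: "A \<subseteq> closure D" "subspace (closure D)"
    and \<eta>: "0 < \<eta>" "\<eta> \<le> 1/2"
  obtains w :: "nat \<Rightarrow> 'a" where "range w \<subseteq> D" "large (span (range w))"
    "\<And>x. x \<in> span (range w) \<Longrightarrow> \<exists>a\<in>A. norm (x - a) \<le> \<eta> * norm a"
proof -
  have "\<exists>B. finite B \<and> B \<subseteq> A \<and> real n < d A norm (span B)" for n
    using A by (auto simp: large_def closure_closed)
  then obtain B where B: "\<And>n. finite (B n)" "\<And>n. B n \<subseteq> A"
      "\<And>n. real n < d A norm (span (B n))"
    by metis
  obtain E where E: "E \<subseteq> (\<Union>n. B n)" "independent E" "(\<Union>n. B n) \<subseteq> span E"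
    using maximal_independent_subset by blast
  have EA: "E \<subseteq> A" using E B by blast
  have "countable (\<Union>n. B n)" using B by (auto intro: countable_finite)
  then have cE: "countable E" using E countable_subset by blast
  have iE: "infinite E"
  proof
    assume f: "finite E"
    obtain n :: nat where n: "d A norm (span E) < n" using reals_Archimedean2 by blast
    have "B n \<subseteq> span E" using E by blast
    then have "d A norm (span (B n)) \<le> d A norm (span E)"
      using A f EA B by (intro degree_mono) auto
    then show False using n B(3)[of n] by simp
  qed
  define e where "e = from_nat_into E"
  have re: "range e = E" and inj: "inj e"
    using bij_betw_from_nat_into[OF cE iE] by (auto simp: e_def bij_betw_def)
  have eA: "e n \<in> A" for n using re EA by blast
  have e_new: "e n \<notin> span (e ` {..<n})" for n
  proof
    assume "e n \<in> span (e ` {..<n})"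
    moreover have "e ` {..<n} \<subseteq> E - {e n}" using re inj by (auto simp: inj_eq)
    ultimately have "e n \<in> span (E - {e n})" using span_mono by blast
    then show False using E(2) re unfolding dependent_def by blast
  qed
  have B_init: "\<exists>N. B n \<subseteq> span (e ` {..<N})" for n
  proof -
    have "\<exists>N. b \<in> span (e ` {..<N})" if "b \<in> span E" for b
      using that
    proof (induction rule: span_induct_alt)
      case base then show ?case by (auto simp: span_zero)
    next
      case (step c x y)
      then obtain N where N: "y \<in> span (e ` {..<N})" by blast
      obtain m where m: "x = e m" using step re by blast
      have "e ` {..<N} \<subseteq> e ` {..<max N (Suc m)}" by auto
      then have "y \<in> span (e ` {..<max N (Suc m)})" using N span_mono by blast
      moreover have "x \<in> span (e ` {..<max N (Suc m)})" using m by (intro span_base) auto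
      ultimately show ?case using span_add span_scale by blast
    qed
    then have "\<forall>b\<in>B n. \<exists>N. b \<in> span (e ` {..<N})" using E by blast
    then obtain N where N: "\<And>b. b \<in> B n \<Longrightarrow> b \<in> span (e ` {..<N b})" by metis
    have "b \<in> span (e ` {..<Max (N ` B n)})" if "b \<in> B n" for b
    proof -
      have "N b \<le> Max (N ` B n)" using that B by auto
      then have "e ` {..<N b} \<subseteq> e ` {..<Max (N ` B n)}" by auto
      then show ?thesis using N[OF that] span_mono by blast
    qed
    then show ?thesis by blast
  qed
  have "\<exists>\<psi> b. bounded_linear \<psi> \<and> 0 < b \<and> (\<forall>x. \<bar>\<psi> x\<bar> \<le> b * norm x) \<and>
      (\<forall>x\<in>span (e ` {..<n}). \<psi> x = (0::real)) \<and> \<psi> (e n) = 1" for n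
  proof -
    let ?G = "span (e ` {..<n})"
    obtain f :: "'a \<Rightarrow> real" where f: "bounded_linear f" "\<And>x. \<bar>f x\<bar> \<le> norm x"
        "\<And>g. g \<in> ?G \<Longrightarrow> f g = 0" "f (e n) = infdist (e n) ?G"
      using functional_attaining_infdist[OF subspace_span, of "e ` {..<n}" "e n"] by blast
    have "closed ?G" by (rule closed_span_finite) simp
    moreover have "?G \<noteq> {}" using span_zero by blast
    ultimately have pos: "0 < f (e n)"
      using f(4) infdist_pos_not_in_closed[of ?G "e n"] e_new[of n] by simp
    have "bounded_linear (\<lambda>x. f x / f (e n))"
      by (rule bounded_linear_compose[OF bounded_linear_divide f(1)])
    then show ?thesis
      by (intro exI[of _ "\<lambda>x. f x / f (e n)"] exI[of _ "1 / f (e n)"])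
         (use f(2,3) pos in \<open>simp add: divide_right_mono\<close>)
  qed
  then obtain \<psi> b where \<psi>: "\<And>n. bounded_linear (\<psi> n)" "\<And>n. 0 < b n"
      "\<And>n x. \<bar>\<psi> n x\<bar> \<le> b n * norm x"
      "\<And>n x. x \<in> span (e ` {..<n}) \<Longrightarrow> \<psi> n x = (0::real)" "\<And>n. \<psi> n (e n) = 1"
    by metis
  \<comment> \<open>The bounds make \<open>norm (R x - x)\<close> at most \<open>\<eta> * norm x\<close>, as the factors \<open>(1/2) ^ Suc n\<close> sum
    to \<open>1\<close>. The vector required to be in \<open>D\<close> will be \<open>R (e n)\<close>.\<close>
  define Good where "Good = (\<lambda>\<delta> n r. r \<in> closure D \<and> norm r \<le> \<eta> * (1/2) ^ Suc n / b n \<and>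
      e n + (\<Sum>k<n. \<psi> k (e n) *\<^sub>R \<delta> k) + r \<in> D)"
  have "\<exists>\<delta>. \<forall>n. Good \<delta> n (\<delta> n)"
  proof (rule dependent_wellorder_choice)
    show "Good f n r = Good g n r" if "\<And>m. m < n \<Longrightarrow> f m = g m" for r n and f g :: "nat \<Rightarrow> 'a"
      using that by (simp add: Good_def)
    fix n and \<delta> :: "nat \<Rightarrow> 'a" assume IH: "\<And>m. m < n \<Longrightarrow> Good \<delta> m (\<delta> m)"
    define y where "y = e n + (\<Sum>k<n. \<psi> k (e n) *\<^sub>R \<delta> k)"
    have y: "y \<in> closure D"
      unfolding y_def using IH eA D
      by (intro subspace_add[OF D(2)] subspace_sum[OF D(2)] subspace_scale[OF D(2)])
         (auto simp: Good_def)
    have "0 < \<eta> * (1/2) ^ Suc n / b n" using \<eta> \<psi>(2) by simp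
    then obtain z where z: "z \<in> D" "dist z y < \<eta> * (1/2) ^ Suc n / b n"
      using y closure_approachable[of y D] by blast
    have "Good \<delta> n (z - y)"
      unfolding Good_def using z y subspace_diff[OF D(2), of z y] closure_subset[of D]
      by (auto simp: y_def[symmetric] dist_norm)
    then show "\<exists>r. Good \<delta> n r" by blast
  qed
  then obtain \<delta> where \<delta>: "\<And>n. norm (\<delta> n) \<le> \<eta> * (1/2) ^ Suc n / b n"
      "\<And>n. e n + (\<Sum>k<n. \<psi> k (e n) *\<^sub>R \<delta> k) + \<delta> n \<in> D"
    by (auto simp: Good_def)
  define Q where "Q = (\<lambda>x. \<Sum>n. \<psi> n x *\<^sub>R \<delta> n)"
  define R where "R = (\<lambda>x. x + Q x)"
  have small: "norm (\<psi> n x *\<^sub>R \<delta> n) \<le> (\<eta> * norm x) * (1/2) ^ Suc n" for n x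
  proof -
    have "norm (\<psi> n x *\<^sub>R \<delta> n) \<le> (b n * norm x) * (\<eta> * (1/2) ^ Suc n / b n)"
      using \<psi>(2)[of n] unfolding norm_scaleR real_norm_def
      by (intro mult_mono \<psi> \<delta>) auto
    then show ?thesis using \<psi>(2)[of n] by (simp add: field_simps)
  qed
  have geo: "(\<lambda>n. (\<eta> * norm x) * (1/2) ^ Suc n) sums (\<eta> * norm x)" for x :: 'a
    using sums_mult[OF power_half_series, of "\<eta> * norm x"] by simp
  have sm: "summable (\<lambda>n. \<psi> n x *\<^sub>R \<delta> n)" for x
    by (rule summable_comparison_test'[OF sums_summable[OF geo[of x]], of 0]) (use small in auto)
  have Qn: "norm (Q x) \<le> \<eta> * norm x" for x
    using norm_suminf_le[OF small sums_summable[OF geo], of x]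
    by (simp only: Q_def sums_unique[OF geo, of x, symmetric])
  have \<psi>_add: "\<psi> n (x + y) = \<psi> n x + \<psi> n y" and \<psi>_scale: "\<psi> n (c *\<^sub>R x) = c * \<psi> n x" for n x y c
    using linear_add[OF bounded_linear.linear[OF \<psi>(1)]]
      linear_scale[OF bounded_linear.linear[OF \<psi>(1)]] by auto
  have Qlin: "linear Q"
  proof (rule linearI)
    show "Q (x + y) = Q x + Q y" for x y
      using suminf_add[OF sm[of x] sm[of y]]
      by (simp add: Q_def \<psi>_add scaleR_add_left)
    show "Q (c *\<^sub>R x) = c *\<^sub>R Q x" for c x
      using suminf_scaleR_right[OF sm[of x], of c]
      by (simp add: Q_def \<psi>_scale)
  qed
  have Rlin: "linear R"
    using linear_add[OF Qlin] linear_scale[OF Qlin]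
    by (intro linearI) (simp_all add: R_def algebra_simps)
  have Rup: "norm (R x) \<le> 2 * norm x" for x
  proof -
    have "norm (R x) \<le> norm x + \<eta> * norm x"
      using norm_triangle_ineq[of x "Q x"] Qn[of x] by (simp add: R_def)
    then show ?thesis
      using mult_right_mono[OF \<eta>(2) norm_ge_zero[of x]] norm_ge_zero[of x] by linarith
  qed
  have Rlow: "(1/2) * norm x \<le> norm (R x)" for x
  proof -
    have "norm x \<le> norm (R x) + norm (Q x)"
      using norm_triangle_ineq4[of "R x" "Q x"] by (simp add: R_def)
    then show ?thesis using Qn[of x] mult_right_mono[OF \<eta>(2) norm_ge_zero[of x]] by linarith
  qed
  have Rbl: "bounded_linear R"
    by (rule bounded_linear_intro[where K = 2])
       (use Rlin Rup in \<open>auto simp: linear_add linear_scale mult.commute\<close>)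
  define w where "w = (\<lambda>n. R (e n))"
  have wD: "range w \<subseteq> D"
  proof -
    have "R (e n) \<in> D" for n
    proof -
      have "\<psi> k (e n) = 0" if "k \<notin> {..n}" for k
        using that by (intro \<psi>(4) span_base) auto
      then have "Q (e n) = (\<Sum>k\<le>n. \<psi> k (e n) *\<^sub>R \<delta> k)"
        unfolding Q_def by (intro suminf_finite) auto
      then have "R (e n) = e n + (\<Sum>k<n. \<psi> k (e n) *\<^sub>R \<delta> k) + \<delta> n"
        by (simp add: R_def lessThan_Suc_atMost[symmetric] \<psi>(5))
      then show ?thesis using \<delta>(2) by simp
    qed
    then show ?thesis by (auto simp: w_def)
  qed
  define A1 where "A1 = closure (span (range e))"
  have A1: "subspace A1" "closed A1" "A1 \<subseteq> A"
    using A eA closure_minimal[OF span_minimal[of "range e" A]]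
    by (auto simp: A1_def subspace_closure)
  have e1: "span (range e) \<subseteq> A1" using closure_subset by (auto simp: A1_def)
  have span_w: "span (range w) = R ` span (range e)"
    using linear_span_image[OF Rlin, of "range e"] by (simp add: w_def image_image)
  let ?U = "span (range w)"
  have "complete (R ` A1)"
    by (rule complete_isometric_image[of "1/2"])
       (use A1 Rbl Rlow complete_eq_closed in auto)
  then have clU: "closure ?U \<subseteq> R ` A1"
    using e1 unfolding span_w by (intro closure_minimal image_mono complete_imp_closed)
  have injR: "inj_on R A1"
  proof (rule inj_onI)
    fix x y assume "R x = R y"
    then have "R (x - y) = 0" using Rlin by (simp add: linear_diff)
    then show "x = y" using Rlow[of "x - y"] by simp
  qed
  define T where "T = inv_into A1 R"
  have TR: "T (R x) = x" if "x \<in> A1" for x using injR that by (simp add: T_def)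
  \<comment> \<open>\<open>R\<close> and its inverse form a morphism of norm at most \<open>4\<close> from the perturbed space to \<open>A\<close>.\<close>
  have "large ?U" unfolding large_def
  proof
    fix M
    obtain n :: nat where n: "K 4 M < n" using reals_Archimedean2 by blast
    obtain N where N: "B n \<subseteq> span (e ` {..<N})" using B_init by blast
    have sN: "span (e ` {..<N}) \<subseteq> A1" using e1 span_mono[of "e ` {..<N}" "range e"] by blast
    have wU: "w ` {..<N} \<subseteq> ?U" using span_superset[of "range w"] by auto
    then have wcl: "w ` {..<N} \<subseteq> closure ?U" using closure_subset[of ?U] by blast
    have "d A norm (span (B n)) \<le> K 4 (d (closure ?U) norm (span (w ` {..<N})))"
    proof (rule degree_le[where S = R and T = T and a = 2 and b = 2])
      show "R x \<in> span (w ` {..<N})" if "x \<in> B n" for x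
        using that N linear_span_image[OF Rlin, of "e ` {..<N}"] by (auto simp: w_def image_image)
      show "T (R x) = x" if "x \<in> span (B n)" for x
        using that N sN span_minimal[OF N] by (intro TR) auto
      fix x assume "x \<in> closure ?U"
      then obtain x' where x': "x' \<in> A1" "x = R x'" using clU by auto
      show "T x \<in> A" using x' A1 by (auto simp: TR)
      show "norm (T x) \<le> 2 * norm x" using x' Rlow[of x'] by (simp add: TR)
      show "T (c *\<^sub>R x) = c *\<^sub>R T x" for c
        using x' A1 TR[of "c *\<^sub>R x'"] by (simp add: TR linear_scale[OF Rlin] subspace_scale)
      fix y assume "y \<in> closure ?U"
      then obtain y' where y': "y' \<in> A1" "y = R y'" using clU by auto
      show "T (x + y) = T x + T y"
        using x' y' A1 TR[of "x' + y'"] by (simp add: TR linear_add[OF Rlin] subspace_add)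
    qed (use A B Rlin Rup wcl in \<open>auto simp: subspace_closure\<close>)
    then have "n < K 4 (d (closure ?U) norm (span (w ` {..<N})))" using B(3)[of n] by simp
    moreover have "0 \<le> d (closure ?U) norm (span (w ` {..<N}))"
      using wcl by (intro nonneg approx_pair_span) (auto simp: subspace_closure)
    ultimately have "M < d (closure ?U) norm (span (w ` {..<N}))"
      using n K_mono[of 4 4 "d (closure ?U) norm (span (w ` {..<N}))" M] by linarith
    then show "\<exists>B. finite B \<and> B \<subseteq> ?U \<and> M < d (closure ?U) norm (span B)"
      using wU by (intro exI[of _ "w ` {..<N}"]) auto
  qed
  moreover have "\<exists>a\<in>A. norm (x - a) \<le> \<eta> * norm a" if x: "x \<in> ?U" for x
  proof -
    obtain a where a: "a \<in> span (range e)" "x = R a" using x span_w by auto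
    then show ?thesis using e1 A1 Qn[of a] by (intro bexI[of _ a]) (auto simp: R_def)
  qed
  ultimately show thesis using that wD by blast
qed

end

section \<open>Finite-dimensional decompositions from separated blocks\<close>

text \<open>In a sequence of blocks, each head is separated from the tail that follows it,
  with a constant that does not depend on the cut. The spans of the blocks then form an FDD of the closed
  span of their union.\<close>

locale blocks =
  fixes s :: "nat \<Rightarrow> 'a::banach set"
  assumes finite_block: "finite (s n)"
    and nonzero: "\<not> s n \<subseteq> {0}"
    and separated: "h \<in> span (\<Union>i<n. s i) \<Longrightarrow> q \<in> closure (span (\<Union>i\<in>{n..}. s i)) \<Longrightarrow>
      norm h \<le> 2 * norm (h + q)"
begin

abbreviation "whole \<equiv> closure (span (\<Union>i. s i))"
abbreviation "head n \<equiv> span (\<Union>i<n. s i)"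
abbreviation "tail n \<equiv> closure (span (\<Union>i\<in>{n..}. s i))"

lemma subspace_tail: "subspace (tail n)" and subspace_whole: "subspace whole"
  by (simp_all add: subspace_closure)

lemma block_head: "i < n \<Longrightarrow> span (s i) \<subseteq> head n"
  by (intro span_mono) auto

lemma block_tail: "n \<le> i \<Longrightarrow> span (s i) \<subseteq> tail n"
  by (rule order_trans[OF span_mono closure_subset]) auto

lemma head_mono: "m \<le> n \<Longrightarrow> head m \<subseteq> head n"
  by (intro span_mono UN_mono) auto

lemma tail_mono: "m \<le> n \<Longrightarrow> tail n \<subseteq> tail m"
  by (intro closure_mono span_mono UN_mono) auto

lemma tail_whole: "tail n \<subseteq> whole"
  by (intro closure_mono span_mono UN_mono) auto

lemma separated_unique:
  assumes "h \<in> head n" "y - h \<in> tail n" "h' \<in> head n" "y - h' \<in> tail n"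
  shows "h = h'"
proof -
  have "(y - h) - (y - h') \<in> tail n" by (rule subspace_diff[OF subspace_tail assms(2,4)])
  then have "h' - h \<in> tail n" by simp
  then have "norm (h - h') \<le> 2 * norm (h - h' + (h' - h))"
    using assms by (intro separated span_diff)
  then show ?thesis by simp
qed

text \<open>The sum of a head and a tail is closed, since the separation makes the head parts of a
  convergent sequence of sums a Cauchy sequence.\<close>

lemma decomposition:
  assumes "y \<in> whole"
  shows "\<exists>h\<in>head n. y - h \<in> tail n"
proof -
  have "\<exists>h\<in>head n. x - h \<in> tail n" if x: "x \<in> span (\<Union>i. s i)" for x
  proof -
    have "{..<n} \<union> {n..} = UNIV" by auto
    then have "(\<Union>i. s i) = (\<Union>i<n. s i) \<union> (\<Union>i\<in>{n..}. s i)" by (metis UN_Un)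
    then obtain a b where ab: "a \<in> head n" "b \<in> span (\<Union>i\<in>{n..}. s i)" "x = a + b"
      using x by (auto simp: span_Un)
    moreover have "b \<in> tail n" using ab(2) closure_subset by blast
    ultimately show ?thesis by (intro bexI[of _ a]) auto
  qed note dec = this
  obtain x where x: "\<And>k. x k \<in> span (\<Union>i. s i)" "x \<longlonglongrightarrow> y"
    using assms by (auto simp: closure_sequential)
  then have "\<forall>k. \<exists>h\<in>head n. x k - h \<in> tail n" using dec by blast
  then obtain h where h: "\<And>k. h k \<in> head n" "\<And>k. x k - h k \<in> tail n" by metis
  have close: "norm (h k - h l) \<le> 2 * norm (x k - x l)" for k l
  proof -
    have "norm (h k - h l) \<le> 2 * norm ((h k - h l) + ((x k - h k) - (x l - h l)))"
      by (rule separated[OF span_diff[OF h(1) h(1)] subspace_diff[OF subspace_tail h(2) h(2)]])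
    then show ?thesis by simp
  qed
  have "Cauchy h"
  proof (rule metric_CauchyI)
    fix e :: real assume "0 < e"
    then obtain M where M: "\<And>k l. k \<ge> M \<Longrightarrow> l \<ge> M \<Longrightarrow> dist (x k) (x l) < e / 2"
      using LIMSEQ_imp_Cauchy[OF x(2)] unfolding Cauchy_def by (meson half_gt_zero)
    have "dist (h k) (h l) < e" if "k \<ge> M" "l \<ge> M" for k l
      using close[of k l] M[OF that] by (simp add: dist_norm)
    then show "\<exists>M. \<forall>m\<ge>M. \<forall>n\<ge>M. dist (h m) (h n) < e" by blast
  qed
  then obtain a where a: "h \<longlonglongrightarrow> a" by (auto simp: Cauchy_convergent_iff convergent_def)
  have "closed (head n)" by (intro closed_span_finite) (simp add: finite_block)
  then have "a \<in> head n" using a h(1) closed_sequentially by blast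
  moreover have "(\<lambda>k. x k - h k) \<longlonglongrightarrow> y - a" using x a by (intro tendsto_diff)
  then have "y - a \<in> tail n" by (rule closed_sequentially[OF closed_closure h(2)])
  ultimately show ?thesis by blast
qed

definition proj :: "nat \<Rightarrow> 'a \<Rightarrow> 'a" where
  "proj n y = (SOME h. h \<in> head n \<and> y - h \<in> tail n)"

lemma proj: "y \<in> whole \<Longrightarrow> proj n y \<in> head n \<and> y - proj n y \<in> tail n"
  unfolding proj_def using decomposition[of y n] by (intro someI_ex[of "\<lambda>h. h \<in> head n \<and> y - h \<in> tail n"]) blast

lemma proj_eq: "h \<in> head n \<Longrightarrow> y - h \<in> tail n \<Longrightarrow> proj n y = h"
  unfolding proj_def by (rule some_equality) (use separated_unique in blast)+

lemma proj_add:
  assumes "x \<in> whole" "y \<in> whole"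
  shows "proj n (x + y) = proj n x + proj n y"
proof (rule proj_eq)
  have "(x - proj n x) + (y - proj n y) \<in> tail n"
    using assms proj by (intro subspace_add subspace_tail) auto
  then show "x + y - (proj n x + proj n y) \<in> tail n" by (simp add: algebra_simps)
qed (use assms proj in \<open>auto intro: span_add\<close>)

lemma proj_scale:
  assumes "x \<in> whole"
  shows "proj n (c *\<^sub>R x) = c *\<^sub>R proj n x"
proof (rule proj_eq)
  have "c *\<^sub>R (x - proj n x) \<in> tail n"
    using assms proj by (intro subspace_scale subspace_tail) auto
  then show "c *\<^sub>R x - c *\<^sub>R proj n x \<in> tail n" by (simp add: algebra_simps)
qed (use assms proj in \<open>auto intro: span_scale\<close>)

lemma norm_proj: "y \<in> whole \<Longrightarrow> norm (proj n y) \<le> 2 * norm y"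
  using separated[of "proj n y" n "y - proj n y"] proj[of y n] by simp

lemma norm_minus_proj: "y \<in> whole \<Longrightarrow> norm (y - proj n y) \<le> 3 * norm y"
  using norm_triangle_ineq4[of y "proj n y"] norm_proj[of y n] by simp

text \<open>The part of \<open>proj (Suc n) y\<close> in the first \<open>n\<close> blocks has to be \<open>proj n y\<close>, because the rest
  of \<open>y\<close> lies in the tail from \<open>n\<close> on.\<close>

lemma proj_diff:
  assumes y: "y \<in> whole"
  shows "proj (Suc n) y - proj n y \<in> span (s n)"
proof -
  have "(\<Union>i<Suc n. s i) = (\<Union>i<n. s i) \<union> s n" by (auto simp: less_Suc_eq)
  moreover have "proj (Suc n) y \<in> head (Suc n)" using proj y by blast
  ultimately obtain a b where ab: "a \<in> head n" "b \<in> span (s n)" "proj (Suc n) y = a + b"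
    by (auto simp: span_Un)
  have "y - proj (Suc n) y \<in> tail n" using proj[OF y, of "Suc n"] tail_mono[of n "Suc n"] by auto
  moreover have "b \<in> tail n" using ab block_tail[of n n] by auto
  ultimately have "(y - proj (Suc n) y) + b \<in> tail n" by (intro subspace_add subspace_tail)
  then have "proj n y = a" using ab by (intro proj_eq) (auto simp: algebra_simps)
  then show ?thesis using ab by simp
qed

text \<open>The projections are uniformly bounded and eventually fix each element of a dense set.\<close>

lemma proj_tendsto:
  assumes y: "y \<in> whole"
  shows "(\<lambda>n. proj n y) \<longlonglongrightarrow> y"
proof (rule metric_LIMSEQ_I)
  fix e :: real assume "0 < e"
  then obtain z where z: "z \<in> span (\<Union>i. s i)" "dist z y < e / 3"
    using y closure_approachable[of y "span (\<Union>i. s i)"] by (meson divide_pos_pos zero_less_numeral)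
  have "\<exists>m. z \<in> head m" using z(1)
  proof (induction rule: span_induct_alt)
    case base then show ?case by (auto simp: span_zero)
  next
    case (step c x y)
    then obtain m i where "y \<in> head m" "x \<in> s i" by auto
    then have "y \<in> head (m + Suc i)" "x \<in> head (m + Suc i)"
      using head_mono[of m "m + Suc i"] block_head[of i "m + Suc i"] span_base[of x "s i"] by auto
    then show ?case using span_add span_scale by blast
  qed
  then obtain m where m: "z \<in> head m" by blast
  have "dist (proj n y) y < e" if "m \<le> n" for n
  proof -
    have zw: "z \<in> whole" using z closure_subset by blast
    have "proj n z = z" using m head_mono[OF that] subspace_0[OF subspace_tail]
      by (intro proj_eq) auto
    then have "proj n y - y = - ((y - z) - proj n (y - z))"
      using proj_add[OF y, of "(-1) *\<^sub>R z" n] proj_scale[OF zw, of n "-1"] zw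
      by (simp add: subspace_neg subspace_whole algebra_simps)
    then have "norm (proj n y - y) \<le> 3 * norm (y - z)"
      using norm_minus_proj[of "y - z" n] y zw subspace_diff[OF subspace_whole] by (metis norm_minus_cancel)
    then show ?thesis using z(2) by (simp add: dist_norm norm_minus_commute)
  qed
  then show "\<exists>m. \<forall>n\<ge>m. dist (proj n y) y < e" by blast
qed

lemma FDD_blocks: "FDD whole (\<lambda>n. span (s n))"
  unfolding FDD_def
proof (intro conjI allI ballI)
  fix n
  show "span (s n) \<subseteq> whole" using block_tail[of n n] tail_whole by blast
  show "span (s n) \<noteq> {0}" using nonzero[of n] span_superset[of "s n"] by metis
next
  fix y assume y: "y \<in> whole"
  show "\<exists>!f. (\<forall>n. f n \<in> span (s n)) \<and> f sums y"
  proof (rule ex1I)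
    have "(\<Sum>i<n. proj (Suc i) y - proj i y) = proj n y" for n
    proof -
      have "proj 0 y = 0" using proj[OF y, of 0] by simp
      then show ?thesis using sum_lessThan_telescope[of "\<lambda>i. proj i y" n] by simp
    qed
    then show "(\<forall>n. proj (Suc n) y - proj n y \<in> span (s n)) \<and> (\<lambda>n. proj (Suc n) y - proj n y) sums y"
      using proj_diff[OF y] proj_tendsto[OF y] by (simp add: sums_def)
  next
    fix f assume f: "(\<forall>n. f n \<in> span (s n)) \<and> f sums y"
    have part: "proj n y = (\<Sum>i<n. f i)" for n
    proof (rule proj_eq)
      show "(\<Sum>i<n. f i) \<in> head n" proof (rule span_sum)
        show "f i \<in> head n" if "i \<in> {..<n}" for i
          using f that block_head[of i n] by auto
      qed
      have "(\<lambda>m. (\<Sum>i<m + n. f i) - (\<Sum>i<n. f i)) \<longlonglongrightarrow> y - (\<Sum>i<n. f i)"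
        using f unfolding sums_def by (intro tendsto_diff tendsto_const LIMSEQ_ignore_initial_segment) blast
      moreover have "(\<Sum>i<m + n. f i) - (\<Sum>i<n. f i) \<in> tail n" for m
      proof -
        have "(\<Sum>i<m + n. f i) - (\<Sum>i<n. f i) = (\<Sum>i\<in>{n..<m + n}. f i)"
          unfolding lessThan_atLeast0 by (rule sum_diff_nat_ivl) auto
        moreover have "(\<Sum>i\<in>{n..<m + n}. f i) \<in> tail n"
        proof (rule subspace_sum[OF subspace_tail])
          show "f i \<in> tail n" if "i \<in> {n..<m + n}" for i
            using f that block_tail[of n i] by auto
        qed
        ultimately show ?thesis by simp
      qed
      ultimately show "y - (\<Sum>i<n. f i) \<in> tail n"
        by (rule closed_sequentially[OF closed_closure, rotated])
    qed
    show "f = (\<lambda>n. proj (Suc n) y - proj n y)" by (rule ext) (simp add: part)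
  qed
qed (auto simp: finite_block fin_dim_span)

text \<open>Splitting a finite stretch of a convergent series into two parts and comparing the sum of the
  parts with their difference bounds each part by the whole stretch.\<close>

lemma UFDD_blocks:
  assumes \<epsilon>: "0 < \<epsilon>"
    and split: "\<And>n A e f. A \<subseteq> {..<n} \<Longrightarrow> e \<in> span (\<Union>i\<in>A. s i) \<Longrightarrow>
      f \<in> span (\<Union>i\<in>{..<n} - A. s i) \<Longrightarrow> \<epsilon> * norm (e + f) \<le> norm (e - f)"
  shows "UFDD whole (\<lambda>n. span (s n))"
  unfolding UFDD_def unconditionally_convergent_def
proof (intro conjI allI impI FDD_blocks)
  fix f and p :: "nat \<Rightarrow> nat"
  assume f: "(\<forall>n. f n \<in> span (s n)) \<and> summable f" and p: "bij p"
  define C where "C = (1 + 1 / \<epsilon>) / 2"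
  have C: "0 < C" using \<epsilon> by (simp add: C_def add_pos_pos)
  have part: "norm (sum f J) \<le> C * norm (sum f {N..<M})" if J: "J \<subseteq> {N..<M}" for J N M
  proof -
    let ?a = "sum f J" and ?b = "sum f ({N..<M} - J)"
    have a: "?a \<in> span (\<Union>i\<in>J. s i)"
    proof (rule span_sum)
      show "f i \<in> span (\<Union>i\<in>J. s i)" if "i \<in> J" for i
        using f span_mono[OF UN_upper[OF that, of s]] by auto
    qed
    have b: "?b \<in> span (\<Union>i\<in>{..<M} - J. s i)"
    proof (rule span_sum)
      show "f i \<in> span (\<Union>i\<in>{..<M} - J. s i)" if "i \<in> {N..<M} - J" for i
      proof -
        have "i \<in> {..<M} - J" using that by auto
        then show ?thesis using f span_mono[OF UN_upper[of i "{..<M} - J" s]] by auto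
      qed
    qed
    have "\<epsilon> * norm (?a + - ?b) \<le> norm (?a - - ?b)"
      by (rule split[OF _ a span_neg[OF b]]) (use J in auto)
    then have "norm (?a - ?b) \<le> norm (?a + ?b) / \<epsilon>" using \<epsilon> by (simp add: field_simps)
    moreover have "norm ((?a + ?b) + (?a - ?b)) \<le> norm (?a + ?b) + norm (?a - ?b)"
      by (rule norm_triangle_ineq)
    moreover have "(?a + ?b) + (?a - ?b) = 2 *\<^sub>R ?a" by (simp add: scaleR_2)
    moreover have "?a + ?b = sum f {N..<M}"
      using J finite_subset[OF J] sum.subset_diff[OF J, of f] by (simp add: add.commute)
    ultimately have "2 * norm ?a \<le> norm (sum f {N..<M}) + norm (sum f {N..<M}) / \<epsilon>" by simp
    then show ?thesis by (simp add: C_def field_simps)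
  qed
  show "summable (\<lambda>n. f (p n))" unfolding summable_Cauchy
  proof (intro allI impI)
    fix e :: real assume e: "0 < e"
    then obtain N where N: "\<And>m n. N \<le> m \<Longrightarrow> norm (sum f {m..<n}) < e / C"
      using f C unfolding summable_Cauchy by (meson divide_pos_pos)
    have "finite (p -` {..<N})" using p by (intro finite_vimageI) (auto simp: bij_def)
    then obtain N' where N': "p -` {..<N} \<subseteq> {..<N'}" using finite_nat_iff_bounded by blast
    have "norm (\<Sum>k\<in>{m..<n}. f (p k)) < e" if "N' \<le> m" for m n
    proof -
      have inj: "inj_on p {m..<n}" using p by (auto simp: bij_def intro: inj_on_subset)
      obtain M where M: "p ` {m..<n} \<subseteq> {..<M}"
        using finite_nat_iff_bounded[of "p ` {m..<n}"] by auto
      have "p k \<ge> N" if "k \<in> {m..<n}" for k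
      proof (rule ccontr)
        assume "\<not> N \<le> p k"
        then have "k \<in> p -` {..<N}" by simp
        then have "k \<in> {..<N'}" using N' by blast
        then show False using that \<open>N' \<le> m\<close> by simp
      qed
      then have "p ` {m..<n} \<subseteq> {N..<M}" using M by auto
      then have "norm (sum f (p ` {m..<n})) \<le> C * norm (sum f {N..<M})" by (rule part)
      also have "\<dots> < e" using N[of N M] C by (simp add: field_simps)
      finally show ?thesis by (simp add: sum.reindex[OF inj])
    qed
    then show "\<exists>N. \<forall>m\<ge>N. \<forall>n. norm (\<Sum>k\<in>{m..<n}. f (p k)) < e" by blast
  qed
qed

end

locale degree_blocks = degree d K + blocks s
  for d :: "'a::banach set \<Rightarrow> ('a \<Rightarrow> real) \<Rightarrow> 'a set \<Rightarrow> real" and K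
    and s :: "nat \<Rightarrow> 'a set" +
  assumes better: "real n < d (closure (span (\<Union>i\<in>{n..}. s i))) norm (span (s n))"
begin

text \<open>The projections of the whole space onto the tails are bounded by \<open>3\<close>, so a block has
  large degree in the whole space if it has large degree in the tail that starts with it.\<close>

lemma degree_whole: "real n < K 3 (d whole norm (span (s n)))"
proof -
  have sw: "s n \<subseteq> whole" "s n \<subseteq> tail n"
    using span_superset[of "s n"] block_tail[of n n] tail_whole[of n] by auto
  have "d (tail n) norm (span (s n)) \<le> K 3 (d whole norm (span (s n)))"
  proof (rule degree_le[where S = "\<lambda>x. x" and T = "\<lambda>y. y - proj n y" and a = 1 and b = 3])
    fix x assume x: "x \<in> whole"
    show "x - proj n x \<in> tail n" using proj[OF x] by blast
    show "norm (x - proj n x) \<le> 3 * norm x" using norm_minus_proj[OF x] .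
    show "c *\<^sub>R x - proj n (c *\<^sub>R x) = c *\<^sub>R (x - proj n x)" for c
      using proj_scale[OF x] by (simp add: algebra_simps)
    fix y assume y: "y \<in> whole"
    show "x + y - proj n (x + y) = x - proj n x + (y - proj n y)"
      using proj_add[OF x y] by (simp add: algebra_simps)
  next
    fix x assume "x \<in> span (s n)"
    then have "proj n x = 0" using block_tail[of n n] by (intro proj_eq) (auto simp: span_zero)
    then show "x - proj n x = x" by simp
  qed (use sw finite_block linear_id[unfolded id_def] in \<open>auto simp: subspace_closure span_base\<close>)
  then show ?thesis using better[of n] by simp
qed

lemma degree_whole_gt:
  assumes "K 3 M \<le> real n"
  shows "M < d whole norm (span (s n))"
proof (rule ccontr)
  assume "\<not> ?thesis"
  moreover have "s n \<subseteq> whole"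
    using span_superset[of "s n"] block_tail[of n n] tail_whole[of n] by auto
  ultimately have "K 3 (d whole norm (span (s n))) \<le> K 3 M"
    by (intro K_mono nonneg approx_pair_span) (auto simp: subspace_whole finite_block)
  then show False using degree_whole[of n] assms by simp
qed

lemma d_better_blocks: "d_better d whole (\<lambda>n. span (s n))"
  unfolding d_better_def filterlim_at_top_dense eventually_sequentially
proof
  fix M
  obtain N :: nat where "K 3 M \<le> N" using real_arch_simple by blast
  then show "\<exists>N. \<forall>n\<ge>N. M < d whole norm (span (s n))"
    by (intro exI[of _ N] allI impI degree_whole_gt) simp
qed

lemma large_span: "large (span (\<Union>i. s i))"
  unfolding large_def
proof
  fix M
  obtain n :: nat where "K 3 M \<le> n" using real_arch_simple by blast
  then have "M < d whole norm (span (s n))" by (rule degree_whole_gt)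
  moreover have "s n \<subseteq> span (\<Union>i. s i)" using span_superset[of "\<Union>i. s i"] by auto
  ultimately show "\<exists>B. finite B \<and> B \<subseteq> span (\<Union>i. s i) \<and> M < d whole norm (span B)"
    using finite_block by blast
qed

end

section \<open>Countable frames\<close>

text \<open>A frame is a countable set \<open>W\<close> of vectors, together with functionals \<open>N t\<close> norming the span of
  each finite \<open>t \<subseteq> W\<close>, that is closed under the operations needed to work inside \<open>W\<close> only. The last
  closure condition makes kernels of functionals from \<open>N\<close> rational in the sense below: it projects
  \<open>x\<close> along \<open>v\<close> onto the kernel of \<open>f\<close>.\<close>

locale frame =
  fixes W :: "'a::banach set" and N :: "'a set \<Rightarrow> ('a \<Rightarrow> real) set"
  assumes countable_W: "countable W"
    and zero_W: "0 \<in> W"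
    and add_W: "x \<in> W \<Longrightarrow> y \<in> W \<Longrightarrow> x + y \<in> W"
    and scale_W: "x \<in> W \<Longrightarrow> of_rat q *\<^sub>R x \<in> W"
    and norming_N: "finite t \<Longrightarrow> norming t (N t)"
    and kernel_W: "finite t \<Longrightarrow> t \<subseteq> W \<Longrightarrow> f \<in> N t \<Longrightarrow> x \<in> W \<Longrightarrow> v \<in> W \<Longrightarrow> x - (f x / f v) *\<^sub>R v \<in> W"

definition frame_step :: "('a::real_normed_vector set \<Rightarrow> ('a \<Rightarrow> real) set) \<Rightarrow> 'a set \<Rightarrow> 'a set" where
  "frame_step N C = C \<union> (\<lambda>(x, y). x + y) ` (C \<times> C) \<union> (\<lambda>(q, x). of_rat q *\<^sub>R x) ` (UNIV \<times> C) \<union>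
     (\<Union>t\<in>{t. finite t \<and> t \<subseteq> C}. \<Union>f\<in>N t. (\<lambda>(x, v). x - (f x / f v) *\<^sub>R v) ` (C \<times> C))"

text \<open>Each step of the iteration keeps the set countable, since a countable set has only countably
  many finite subsets and each of them brings in only finitely many functionals.\<close>

lemma frame_exists:
  fixes D :: "'a::banach set"
  assumes D: "countable D"
  obtains W N where "frame W N" "D \<subseteq> W"
proof -
  obtain N where N: "\<And>t :: 'a set. finite t \<Longrightarrow> norming t (N t)"
    using norming_exists by metis
  define C where "C = (\<lambda>n. (frame_step N ^^ n) (insert 0 D))"
  have C_Suc: "C (Suc n) = frame_step N (C n)" for n by (simp add: C_def)
  have countable_C: "countable (C n)" for n
  proof (induction n)
    case 0 then show ?case using D by (simp add: C_def)
  next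
    case (Suc n)
    have "countable {t. finite t \<and> t \<subseteq> C n}"
      using countable_Collect_finite_subset[OF Suc] .
    moreover have "countable (N t)" if "t \<in> {t. finite t \<and> t \<subseteq> C n}" for t
      using N that by (auto simp: norming_def intro: countable_finite)
    ultimately show ?case
      unfolding C_Suc frame_step_def using Suc
      by (intro countable_Un countable_UN countable_image countable_SIGMA) auto
  qed
  have step: "C n \<subseteq> C (Suc n)" for n by (auto simp: C_Suc frame_step_def)
  have mono: "C m \<subseteq> C n" if "m \<le> n" for m n
    using lift_Suc_mono_le[of C, OF step that] .
  define W where "W = (\<Union>n. C n)"
  have pair: "\<exists>n. x \<in> C n \<and> y \<in> C n" if xy: "x \<in> W" "y \<in> W" for x y
  proof -
    obtain i j where "x \<in> C i" "y \<in> C j" using xy by (auto simp: W_def)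
    then show ?thesis using mono[of i "max i j"] mono[of j "max i j"] by (intro exI[of _ "max i j"]) auto
  qed
  have finite_stage: "\<exists>n. t \<subseteq> C n" if "finite t" "t \<subseteq> W" for t
    using that
  proof (induction t)
    case (insert x t)
    then obtain i j where "x \<in> C i" "t \<subseteq> C j" by (auto simp: W_def)
    then show ?case using mono[of i "max i j"] mono[of j "max i j"] by (intro exI[of _ "max i j"]) auto
  qed simp
  have "frame W N"
  proof
    show "0 \<in> W" by (auto simp: W_def C_def intro: exI[of _ 0])
    show "countable W" using countable_C by (auto simp: W_def)
    show "x + y \<in> W" if xy: "x \<in> W" "y \<in> W" for x y
    proof -
      obtain n where "x \<in> C n" "y \<in> C n" using pair[OF xy] by blast
      then have "x + y \<in> C (Suc n)" by (force simp: C_Suc frame_step_def)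
      then show ?thesis by (auto simp: W_def)
    qed
    show "of_rat q *\<^sub>R x \<in> W" if "x \<in> W" for q x
    proof -
      obtain n where "x \<in> C n" using \<open>x \<in> W\<close> by (auto simp: W_def)
      then have "of_rat q *\<^sub>R x \<in> C (Suc n)" by (force simp: C_Suc frame_step_def)
      then show ?thesis by (auto simp: W_def)
    qed
    show "x - (f x / f v) *\<^sub>R v \<in> W"
      if t: "finite t" "t \<subseteq> W" and f: "f \<in> N t" and xv: "x \<in> W" "v \<in> W" for t f x v
    proof -
      obtain i where i: "x \<in> C i" "v \<in> C i" using pair[OF xv] by blast
      obtain j where j: "t \<subseteq> C j" using finite_stage[OF t] by blast
      define n where "n = max i j"
      have n: "x \<in> C n" "v \<in> C n" "t \<subseteq> C n"
        using i j mono[of i n] mono[of j n] by (auto simp: n_def)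
      have "x - (f x / f v) *\<^sub>R v \<in> (\<lambda>(x, v). x - (f x / f v) *\<^sub>R v) ` (C n \<times> C n)"
        using n by force
      then have "x - (f x / f v) *\<^sub>R v \<in> C (Suc n)"
        unfolding C_Suc frame_step_def using n t(1) f by blast
      then show ?thesis by (auto simp: W_def)
    qed
  qed (use N in auto)
  moreover have "C 0 \<subseteq> W" unfolding W_def by (rule UN_upper) simp
  then have "D \<subseteq> W" by (simp add: C_def)
  ultimately show thesis using that by blast
qed

lemma subspace_closure_rational:
  fixes V :: "'a::real_normed_vector set"
  assumes V: "V \<noteq> {}" "\<And>x y. x \<in> V \<Longrightarrow> y \<in> V \<Longrightarrow> x + y \<in> V" "\<And>q x. x \<in> V \<Longrightarrow> of_rat q *\<^sub>R x \<in> V"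
  shows "subspace (closure V)"
proof (rule subspaceI)
  obtain v where "v \<in> V" using V(1) by blast
  then have "0 \<in> V" using V(3)[of v 0] by simp
  then show "0 \<in> closure V" using closure_subset[of V] by blast
next
  fix x y assume "x \<in> closure V" "y \<in> closure V"
  then obtain a b where ab: "\<forall>n. a n \<in> V" "a \<longlonglongrightarrow> x" "\<forall>n. b n \<in> V" "b \<longlonglongrightarrow> y"
    by (auto simp: closure_sequential)
  then have "\<forall>n. a n + b n \<in> V" "(\<lambda>n. a n + b n) \<longlonglongrightarrow> x + y"
    by (auto intro: V(2) tendsto_add)
  then show "x + y \<in> closure V" unfolding closure_sequential by (intro exI[of _ "\<lambda>n. a n + b n"]) auto
next
  fix c x assume "x \<in> closure V"
  then obtain a where a: "\<forall>n. a n \<in> V" "a \<longlonglongrightarrow> x" by (auto simp: closure_sequential)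
  have "\<exists>q. \<bar>of_rat q - c\<bar> < 1 / real (Suc n)" for n
  proof -
    obtain q where "c < of_rat q" "of_rat q < c + 1 / real (Suc n)"
      using of_rat_dense[of c "c + 1 / real (Suc n)"] by auto
    then show ?thesis by (intro exI[of _ q]) auto
  qed
  then obtain q where q: "\<And>n. \<bar>of_rat (q n) - c\<bar> < 1 / real (Suc n)" by metis
  have "(\<lambda>n. of_rat (q n) - c) \<longlonglongrightarrow> 0"
    by (rule Lim_null_comparison[OF _ LIMSEQ_Suc[OF lim_1_over_n]])
       (use q in \<open>auto intro!: always_eventually less_imp_le\<close>)
  then have "(\<lambda>n. of_rat (q n)) \<longlonglongrightarrow> c" by (simp add: LIM_zero_iff)
  then have "(\<lambda>n. of_rat (q n) *\<^sub>R a n) \<longlonglongrightarrow> c *\<^sub>R x" using a by (intro tendsto_scaleR)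
  then show "c *\<^sub>R x \<in> closure V"
    unfolding closure_sequential using a V(3) by (intro exI[of _ "\<lambda>n. of_rat (q n) *\<^sub>R a n"]) auto
qed

context frame
begin

text \<open>Rational subspaces are determined by their vectors in \<open>W\<close>. They can thus be handled by
  means of the countably many finite subsets of \<open>W\<close>.\<close>

definition rational :: "'a set \<Rightarrow> bool" where
  "rational U \<longleftrightarrow> subspace U \<and> U \<subseteq> span (U \<inter> W)"

text \<open>The functionals chosen for a subset of \<open>t\<close> need not be among those chosen for \<open>t\<close>. Taking all
  of them into account makes the annihilator antitone in \<open>t\<close>.\<close>

definition annihilator :: "'a set \<Rightarrow> 'a set" where
  "annihilator t = {x. \<forall>f\<in>(\<Union>u\<in>Pow t. N u). f x = 0}"

lemma N_linear: "finite t \<Longrightarrow> f \<in> N t \<Longrightarrow> bounded_linear f"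
  using norming_N by (auto simp: norming_def)

lemma annihilator_antimono: "t \<subseteq> u \<Longrightarrow> annihilator u \<subseteq> annihilator t"
  by (auto simp: annihilator_def)

lemma finite_annihilator_functionals:
  assumes "finite t"
  shows "finite (\<Union>u\<in>Pow t. N u)"
  using assms norming_N finite_subset[OF _ assms] by (auto simp: norming_def)

lemma annihilator_functional_linear:
  assumes "finite t" "f \<in> (\<Union>u\<in>Pow t. N u)"
  shows "bounded_linear f"
  using assms N_linear finite_subset[OF _ assms(1)] by auto

lemma annihilator_Inter: "annihilator t = (\<Inter>f\<in>(\<Union>u\<in>Pow t. N u). f -` {0})"
  by (auto simp: annihilator_def)

lemma subspace_annihilator:
  assumes "finite t"
  shows "subspace (annihilator t)"
  unfolding annihilator_Inter
proof (rule subspace_Inter, safe)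
  fix f u assume "f \<in> N u" "u \<subseteq> t"
  then interpret f: bounded_linear f using N_linear finite_subset[OF _ assms] by blast
  show "subspace (f -` {0})" by (auto simp: subspace_def f.zero f.add f.scaleR)
qed

lemma closed_annihilator:
  assumes "finite t"
  shows "closed (annihilator t)"
  unfolding annihilator_Inter
proof (intro closed_INT ballI)
  fix f assume "f \<in> (\<Union>u\<in>Pow t. N u)"
  then have "bounded_linear f" by (rule annihilator_functional_linear[OF assms])
  then show "closed (f -` {0})"
    by (intro closed_vimage linear_continuous_on) auto
qed

lemma annihilator_separates:
  assumes "finite t" "h \<in> span t" "x \<in> annihilator t"
  shows "norm h \<le> 2 * norm (h + x)"
proof (rule norming_separates[OF norming_N[OF assms(1)] assms(2)])
  show "f x = 0" if "f \<in> N t" for f using assms(3) that by (auto simp: annihilator_def)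
qed

lemma rational_subspace: "rational U \<Longrightarrow> subspace U"
  by (simp add: rational_def)

lemma rational_span:
  assumes "s \<subseteq> W"
  shows "rational (span s)"
proof -
  have "s \<subseteq> span s \<inter> W" using assms span_superset[of s] by auto
  then show ?thesis by (simp add: rational_def span_mono)
qed

text \<open>The projection onto the kernel along a vector \<open>v \<in> U \<inter> W\<close> maps \<open>U \<inter> W\<close> into \<open>W\<close>, so it maps
  a spanning set of \<open>U\<close> to a spanning set of the kernel inside \<open>W\<close>.\<close>

lemma rational_Int_kernel:
  assumes U: "rational U" and f: "linear f" and ker: "\<And>x v. x \<in> W \<Longrightarrow> v \<in> W \<Longrightarrow> x - (f x / f v) *\<^sub>R v \<in> W"
  shows "rational (U \<inter> {x. f x = (0::real)})"
proof (cases "U \<inter> W \<subseteq> {x. f x = 0}")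
  case True
  have "subspace {x. f x = 0}" using f by (auto simp: subspace_def linear_0 linear_add linear_scale)
  then have "span (U \<inter> W) \<subseteq> {x. f x = 0}" using True by (intro span_minimal)
  then have "U \<subseteq> {x. f x = 0}" using U by (auto simp: rational_def)
  then show ?thesis using U by (simp add: Int_absorb2)
next
  case False
  then obtain v where v: "v \<in> U" "v \<in> W" "f v \<noteq> 0" by auto
  define U0 where "U0 = U \<inter> {x. f x = 0}"
  define L where "L = (\<lambda>x. x - (f x / f v) *\<^sub>R v)"
  have "linear L"
    by (rule linearI) (simp_all add: L_def linear_add[OF f] linear_scale[OF f] add_divide_distrib algebra_simps)
  have LU: "L x \<in> U0" if "x \<in> U" for x
    using v that rational_subspace[OF U]
    by (auto simp: U0_def L_def linear_diff[OF f] linear_scale[OF f] intro: subspace_diff subspace_scale)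
  have fixed: "L x = x" if "x \<in> U0" for x using that by (simp add: L_def U0_def)
  have "subspace U0"
    unfolding U0_def using rational_subspace[OF U] f
    by (intro subspace_inter) (auto simp: subspace_def linear_0 linear_add linear_scale)
  moreover have "U0 \<subseteq> span (U0 \<inter> W)"
  proof
    fix x assume x: "x \<in> U0"
    then have "x \<in> span (U \<inter> W)" using U by (auto simp: rational_def U0_def)
    then have "L x \<in> span (L ` (U \<inter> W))" using linear_span_image[OF \<open>linear L\<close>, of "U \<inter> W"] by blast
    moreover have "L ` (U \<inter> W) \<subseteq> U0 \<inter> W" using LU ker v by (auto simp: L_def)
    ultimately show "x \<in> span (U0 \<inter> W)" using span_mono[of "L ` (U \<inter> W)" "U0 \<inter> W"] fixed[OF x] by auto
  qed
  ultimately show ?thesis by (simp add: rational_def U0_def)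
qed

lemma rational_Int_annihilator:
  assumes U: "rational U" and t: "finite t" "t \<subseteq> W"
  shows "rational (U \<inter> annihilator t)"
proof -
  have "rational (U \<inter> {x. \<forall>f\<in>\<Phi>. f x = 0})" if "finite \<Phi>" "\<Phi> \<subseteq> (\<Union>u\<in>Pow t. N u)" for \<Phi>
    using that
  proof (induction \<Phi>)
    case empty then show ?case using U by simp
  next
    case (insert f \<Phi>)
    then obtain u where u: "u \<subseteq> t" "f \<in> N u" by auto
    have "finite u" using u t finite_subset by blast
    moreover have "u \<subseteq> W" using u t by blast
    ultimately have "rational ((U \<inter> {x. \<forall>f\<in>\<Phi>. f x = 0}) \<inter> {x. f x = 0})"
      using insert u N_linear kernel_W
      by (intro rational_Int_kernel bounded_linear.linear) auto
    moreover have "(U \<inter> {x. \<forall>f\<in>\<Phi>. f x = 0}) \<inter> {x. f x = 0} = U \<inter> {x. \<forall>f\<in>insert f \<Phi>. f x = 0}"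
      by auto
    ultimately show ?case by simp
  qed
  from this[OF finite_annihilator_functionals[OF t(1)]] show ?thesis
    by (simp add: annihilator_def)
qed

lemma rational_dense:
  assumes U: "rational U"
  shows "U \<subseteq> closure (U \<inter> W)" "subspace (closure (U \<inter> W))"
proof -
  show s: "subspace (closure (U \<inter> W))"
  proof (rule subspace_closure_rational)
    show "U \<inter> W \<noteq> {}" using zero_W subspace_0[OF rational_subspace[OF U]] by blast
  qed (use rational_subspace[OF U] add_W scale_W in \<open>auto intro: subspace_add subspace_scale\<close>)
  have "U \<subseteq> span (U \<inter> W)" using U by (simp add: rational_def)
  also have "\<dots> \<subseteq> closure (U \<inter> W)" by (rule span_minimal[OF closure_subset s])
  finally show "U \<subseteq> closure (U \<inter> W)" .
qed

end

section \<open>Deciding pairs of finite sets\<close>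

locale degree_frame = degree d K + frame W N
  for d :: "'a::banach set \<Rightarrow> ('a \<Rightarrow> real) \<Rightarrow> 'a set \<Rightarrow> real" and K and W :: "'a set" and N
begin

text \<open>The conditions of the forcing argument.\<close>

definition condition :: "'a set \<Rightarrow> bool" where
  "condition U \<longleftrightarrow> rational U \<and> large U"

lemma condition_subspace: "condition U \<Longrightarrow> subspace U"
  by (simp add: condition_def rational_subspace)

lemma condition_Int_annihilator:
  assumes "condition U" "finite t" "t \<subseteq> W"
  shows "condition (U \<inter> annihilator t)"
proof -
  have "large (U \<inter> {x. \<forall>f\<in>(\<Union>u\<in>Pow t. N u). f x = 0})"
    using assms finite_annihilator_functionals annihilator_functional_linear
    by (intro large_Int_kernels) (auto simp: condition_def rational_subspace)
  then show ?thesis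
    using assms rational_Int_annihilator by (auto simp: condition_def annihilator_def)
qed

text \<open>The set \<open>r\<close> is suitable as a spanning set of the \<open>n\<close>-th block, to be taken from \<open>Z\<close> after blocks whose
  spanning sets have union \<open>t\<close>.\<close>

definition fits :: "'a set \<Rightarrow> 'a set \<Rightarrow> nat \<Rightarrow> 'a set \<Rightarrow> bool" where
  "fits Z t n r \<longleftrightarrow> finite r \<and> r \<subseteq> Z \<inter> annihilator t \<inter> W \<and> \<not> r \<subseteq> {0} \<and>
     real n < d (closure (Z \<inter> annihilator t)) norm (span r)"

lemma fits_exists:
  assumes Z: "condition Z" and t: "finite t" "t \<subseteq> W"
  shows "\<exists>r. fits Z t n r"
proof -
  define Y where "Y = Z \<inter> annihilator t"
  have Y: "condition Y" unfolding Y_def using assms by (rule condition_Int_annihilator)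
  have sY: "subspace Y" and YW: "Y \<subseteq> span (Y \<inter> W)"
    using Y by (auto simp: condition_def rational_def)
  obtain B where B: "finite B" "B \<subseteq> Y" "real n < d (closure Y) norm (span B)"
    using Y by (auto simp: condition_def large_def)
  have "\<exists>r. finite r \<and> r \<subseteq> Y \<inter> W \<and> b \<in> span r" if "b \<in> Y" for b
  proof -
    have "b \<in> span (Y \<inter> W)" using that YW by blast
    then obtain r u where r: "finite r" "r \<subseteq> Y \<inter> W" "b = (\<Sum>a\<in>r. u a *\<^sub>R a)"
      by (auto simp: span_explicit)
    have "(\<Sum>a\<in>r. u a *\<^sub>R a) \<in> span r" by (intro span_sum span_scale span_base)
    then show ?thesis using r by blast
  qed
  then obtain r where r: "\<And>b. b \<in> Y \<Longrightarrow> finite (r b) \<and> r b \<subseteq> Y \<inter> W \<and> b \<in> span (r b)"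
    by metis
  have "\<not> Y \<inter> W \<subseteq> {0}"
  proof
    assume "Y \<inter> W \<subseteq> {0}"
    then have "Y \<subseteq> span {0}" using YW span_mono[of "Y \<inter> W" "{0}"] by auto
    then have "fin_dim Y" by (auto simp: fin_dim_def intro!: exI[of _ "{0}"])
    then show False using Y large_not_fin_dim[OF sY] by (simp add: condition_def)
  qed
  then obtain w where w: "w \<in> Y \<inter> W" "w \<noteq> 0" by blast
  define s where "s = insert w (\<Union>b\<in>B. r b)"
  have s: "finite s" "s \<subseteq> Y \<inter> W" using B r w by (auto simp: s_def)
  have "B \<subseteq> span s"
  proof
    fix b assume b: "b \<in> B"
    then have "span (r b) \<subseteq> span s" by (intro span_mono) (auto simp: s_def)
    moreover have "b \<in> span (r b)" using r[of b] b B(2) by blast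
    ultimately show "b \<in> span s" by blast
  qed
  then have "d (closure Y) norm (span B) \<le> d (closure Y) norm (span s)"
    using s B sY closure_subset[of Y] by (intro degree_mono) (auto simp: subspace_closure)
  then have "fits Z t n s" using s w B by (auto simp: fits_def Y_def[symmetric] s_def)
  then show ?thesis by blast
qed

text \<open>The \<open>n\<close>-th tail is contained in the closed space in which the degree of the \<open>n\<close>-th block was
  arranged to exceed \<open>n\<close>, and that degree only grows in the smaller space.\<close>

lemma degree_blocks_fits:
  assumes fits: "\<And>n. fits (Z n) (\<Union>i<n. s i) n (s n)"
    and Z: "\<And>n. subspace (Z n)" "\<And>m n. m \<le> n \<Longrightarrow> Z n \<subseteq> Z m"
  shows "degree_blocks d K s"
proof
  fix n
  have fin: "finite (s n)" for n using fits[of n] by (simp add: fits_def)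
  then have fin_head: "finite (\<Union>i<n. s i)" by simp
  have tail: "closure (span (\<Union>i\<in>{n..}. s i)) \<subseteq> closure (Z n \<inter> annihilator (\<Union>i<n. s i))"
  proof (intro closure_mono span_minimal)
    show "(\<Union>i\<in>{n..}. s i) \<subseteq> Z n \<inter> annihilator (\<Union>i<n. s i)"
    proof (intro UN_least)
      fix i assume "i \<in> {n..}"
      then have "n \<le> i" by simp
      then have "Z i \<subseteq> Z n" "annihilator (\<Union>j<i. s j) \<subseteq> annihilator (\<Union>j<n. s j)"
        by (rule Z(2)) (use \<open>n \<le> i\<close> in \<open>intro annihilator_antimono UN_mono; simp\<close>)
      then show "s i \<subseteq> Z n \<inter> annihilator (\<Union>i<n. s i)" using fits[of i] by (auto simp: fits_def)
    qed
    show "subspace (Z n \<inter> annihilator (\<Union>i<n. s i))"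
      by (intro subspace_inter Z subspace_annihilator fin_head)
  qed
  show "finite (s n)" by (rule fin)
  show "\<not> s n \<subseteq> {0}" using fits[of n] by (simp add: fits_def)
  show "norm h \<le> 2 * norm (h + q)"
    if h: "h \<in> span (\<Union>i<n. s i)" and q: "q \<in> closure (span (\<Union>i\<in>{n..}. s i))" for h q
  proof (rule annihilator_separates[OF fin_head h])
    have "closure (Z n \<inter> annihilator (\<Union>i<n. s i)) \<subseteq> annihilator (\<Union>i<n. s i)"
      by (intro closure_minimal closed_annihilator fin_head) auto
    then show "q \<in> annihilator (\<Union>i<n. s i)" using q tail by blast
  qed
  have "s n \<subseteq> (\<Union>i\<in>{n..}. s i)" by auto
  then have sub: "s n \<subseteq> closure (span (\<Union>i\<in>{n..}. s i))"
    using span_superset[of "\<Union>i\<in>{n..}. s i"] closure_subset[of "span (\<Union>i\<in>{n..}. s i)"] by blast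
  have "d (closure (Z n \<inter> annihilator (\<Union>i<n. s i))) norm (span (s n))
      \<le> d (closure (span (\<Union>i\<in>{n..}. s i))) norm (span (s n))"
    using fin tail sub Z fin_head
    by (intro degree_mono) (auto simp: subspace_closure subspace_inter subspace_annihilator span_base)
  then show "real n < d (closure (span (\<Union>i\<in>{n..}. s i))) norm (span (s n))"
    using fits[of n] by (auto simp: fits_def)
qed

text \<open>A decreasing sequence of conditions has a lower bound up to finitely many constraints: blocks
  taken from the successive conditions, each annihilated by functionals norming the
  earlier ones, span a condition.\<close>

lemma diagonal_condition:
  assumes Z: "\<And>n. condition (Z n)" "\<And>n. Z (Suc n) \<subseteq> Z n"
  obtains Y where "condition Y" "Y \<subseteq> Z 0" "\<And>n. \<exists>t. finite t \<and> t \<subseteq> W \<and> Y \<inter> annihilator t \<subseteq> Z n"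
proof -
  have mono: "Z n \<subseteq> Z m" if "m \<le> n" for m n
    using lift_Suc_antimono_le[of Z, OF Z(2) that] .
  have "\<exists>s. \<forall>n. fits (Z n) (\<Union>i<n. s i) n (s n)"
  proof (rule dependent_wellorder_choice)
    show "fits (Z n) (\<Union>i<n. f i) n r = fits (Z n) (\<Union>i<n. g i) n r"
      if "\<And>m. m < n \<Longrightarrow> f m = g m" for r n and f g :: "nat \<Rightarrow> 'a set"
      using that by simp
    show "\<exists>r. fits (Z n) (\<Union>i<n. s i) n r"
      if "\<And>m. m < n \<Longrightarrow> fits (Z m) (\<Union>i<m. s i) m (s m)" for n s
      using that by (intro fits_exists Z) (auto simp: fits_def)
  qed
  then obtain s where s: "\<And>n. fits (Z n) (\<Union>i<n. s i) n (s n)" by blast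
  interpret degree_blocks d K s
    using s mono Z(1) by (intro degree_blocks_fits) (auto simp: condition_subspace)
  have sW: "s n \<subseteq> W" for n using s[of n] by (auto simp: fits_def)
  let ?Y = "span (\<Union>i. s i)"
  have "condition ?Y" unfolding condition_def using sW by (intro conjI rational_span large_span) auto
  moreover have "?Y \<subseteq> Z 0"
    using s mono[of 0] Z(1) by (intro span_minimal condition_subspace) (fastforce simp: fits_def)+
  moreover have "\<exists>t. finite t \<and> t \<subseteq> W \<and> ?Y \<inter> annihilator t \<subseteq> Z n" for n
  proof (intro exI conjI)
    let ?t = "\<Union>i<n. s i" and ?T = "\<Union>i\<in>{n..}. s i"
    show fin: "finite ?t" using finite_block by simp
    show "?t \<subseteq> W" using sW by auto
    have "?T \<subseteq> Z n \<inter> annihilator ?t"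
    proof (intro UN_least)
      fix i assume "i \<in> {n..}"
      then have "n \<le> i" by simp
      then have "Z i \<subseteq> Z n" "annihilator (\<Union>j<i. s j) \<subseteq> annihilator ?t"
        by (rule mono) (use \<open>n \<le> i\<close> in \<open>intro annihilator_antimono UN_mono; simp\<close>)
      then show "s i \<subseteq> Z n \<inter> annihilator ?t" using s[of i] by (auto simp: fits_def)
    qed
    then have T: "span ?T \<subseteq> Z n \<inter> annihilator ?t"
      by (intro span_minimal subspace_inter condition_subspace[OF Z(1)] subspace_annihilator fin)
    show "?Y \<inter> annihilator ?t \<subseteq> Z n"
    proof
      fix x assume x: "x \<in> ?Y \<inter> annihilator ?t"
      have "{..<n} \<union> {n..} = UNIV" by auto
      then have "(\<Union>i. s i) = ?t \<union> ?T" by (metis UN_Un)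
      then obtain a b where ab: "a \<in> span ?t" "b \<in> span ?T" "x = a + b"
        using x by (auto simp: span_Un)
      have "- a \<in> annihilator ?t"
        using x ab T subspace_diff[OF subspace_annihilator[OF fin], of b x] by auto
      then have "a = 0" using annihilator_separates[OF fin ab(1), of "- a"] by simp
      then show "x \<in> Z n" using ab T by auto
    qed
  qed
  ultimately show thesis using that by blast
qed

text \<open>Acceptance means that \<open>E\<close> and \<open>F\<close> cannot be prolonged by conditions inside \<open>Z\<close> without making
  the resulting spaces almost intersect.\<close>

definition accepts :: "real \<Rightarrow> 'a set \<Rightarrow> 'a set \<Rightarrow> 'a set \<Rightarrow> bool" where
  "accepts \<epsilon> E F Z \<longleftrightarrow> (\<forall>U V. condition U \<and> condition V \<and> U \<subseteq> Z \<and> V \<subseteq> Z \<longrightarrow>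
     (\<exists>e\<in>span E. \<exists>u\<in>U. \<exists>f\<in>span F. \<exists>v\<in>V.
        norm ((e + u) - (f + v)) < \<epsilon> * norm ((e + u) + (f + v))))"

definition decides :: "real \<Rightarrow> 'a set \<Rightarrow> 'a set \<Rightarrow> 'a set \<Rightarrow> bool" where
  "decides \<epsilon> E F Z \<longleftrightarrow>
     accepts \<epsilon> E F Z \<or> (\<forall>U. condition U \<and> U \<subseteq> Z \<longrightarrow> \<not> accepts \<epsilon> E F U)"

lemma accepts_mono: "accepts \<epsilon> E F Z \<Longrightarrow> Y \<subseteq> Z \<Longrightarrow> accepts \<epsilon> E F Y"
  unfolding accepts_def by (meson order_trans)

lemma decides_exists:
  assumes "condition Z"
  shows "\<exists>Y. condition Y \<and> Y \<subseteq> Z \<and> decides \<epsilon> E F Y"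
  using assms unfolding decides_def by (cases "\<exists>U. condition U \<and> U \<subseteq> Z \<and> accepts \<epsilon> E F U") blast+

text \<open>Acceptance speaks of all smaller conditions, and cutting down a condition by finitely many
  functionals gives a condition again. So finitely many constraints do not matter.\<close>

lemma accepts_almost_subset:
  assumes t: "finite t" "t \<subseteq> W" and sub: "Y \<inter> annihilator t \<subseteq> Z" and acc: "accepts \<epsilon> E F Z"
  shows "accepts \<epsilon> E F Y"
  unfolding accepts_def
proof (intro allI impI)
  fix U V assume UV: "condition U \<and> condition V \<and> U \<subseteq> Y \<and> V \<subseteq> Y"
  have "condition (U \<inter> annihilator t)" "condition (V \<inter> annihilator t)"
    using UV t condition_Int_annihilator by auto
  moreover have "U \<inter> annihilator t \<subseteq> Z" "V \<inter> annihilator t \<subseteq> Z" using UV sub by auto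
  ultimately have "\<exists>e\<in>span E. \<exists>u\<in>U \<inter> annihilator t. \<exists>f\<in>span F. \<exists>v\<in>V \<inter> annihilator t.
      norm ((e + u) - (f + v)) < \<epsilon> * norm ((e + u) + (f + v))"
    using acc unfolding accepts_def by blast
  then show "\<exists>e\<in>span E. \<exists>u\<in>U. \<exists>f\<in>span F. \<exists>v\<in>V.
      norm ((e + u) - (f + v)) < \<epsilon> * norm ((e + u) + (f + v))" by blast
qed

lemma decides_almost_subset:
  assumes t: "finite t" "t \<subseteq> W" and sub: "Y \<inter> annihilator t \<subseteq> Z" and dec: "decides \<epsilon> E F Z"
  shows "decides \<epsilon> E F Y"
proof (cases "accepts \<epsilon> E F Z")
  case True
  then show ?thesis using accepts_almost_subset[OF t sub] by (simp add: decides_def)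
next
  case False
  have "\<not> accepts \<epsilon> E F U" if U: "condition U" "U \<subseteq> Y" for U
  proof
    assume "accepts \<epsilon> E F U"
    then have "accepts \<epsilon> E F (U \<inter> annihilator t)" by (rule accepts_mono) auto
    moreover have "condition (U \<inter> annihilator t)" "U \<inter> annihilator t \<subseteq> Z"
      using U t sub condition_Int_annihilator by auto
    ultimately show False using dec False unfolding decides_def by blast
  qed
  then show ?thesis by (simp add: decides_def)
qed

text \<open>There are only countably many finite subsets of \<open>W\<close>, so all decisions can be made by one
  condition.\<close>

lemma decides_all:
  assumes Z0: "condition Z0"
  obtains Z where "condition Z" "Z \<subseteq> Z0"
    "\<And>E F k. finite E \<Longrightarrow> E \<subseteq> W \<Longrightarrow> finite F \<Longrightarrow> F \<subseteq> W \<Longrightarrow> decides (1 / real (Suc k)) E F Z"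
proof -
  define P where "P = {t. finite t \<and> t \<subseteq> W}"
  define T where "T = P \<times> P \<times> (UNIV :: nat set)"
  have "countable P" unfolding P_def by (rule countable_Collect_finite_subset[OF countable_W])
  then have cT: "countable T" by (simp add: T_def)
  have "({}, {}, 0) \<in> T" by (simp add: T_def P_def)
  then have neT: "T \<noteq> {}" by blast
  define \<tau> where "\<tau> = from_nat_into T"
  have "\<exists>Z. \<forall>n. (condition (Z n) \<and> Z n \<subseteq> Z0 \<and>
      (case \<tau> n of (E, F, k) \<Rightarrow> decides (1 / real (Suc k)) E F (Z n))) \<and> Z (Suc n) \<subseteq> Z n"
  proof (rule dependent_nat_choice)
    show "\<exists>Z. condition Z \<and> Z \<subseteq> Z0 \<and> (case \<tau> 0 of (E, F, k) \<Rightarrow> decides (1 / real (Suc k)) E F Z)"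
      by (cases "\<tau> 0") (use decides_exists[OF Z0] in simp)
    show "\<exists>Z'. (condition Z' \<and> Z' \<subseteq> Z0 \<and>
        (case \<tau> (Suc n) of (E, F, k) \<Rightarrow> decides (1 / real (Suc k)) E F Z')) \<and> Z' \<subseteq> Z"
      if Z: "condition Z \<and> Z \<subseteq> Z0 \<and> (case \<tau> n of (E, F, k) \<Rightarrow> decides (1 / real (Suc k)) E F Z)" for Z n
    proof -
      obtain E F k where \<tau>: "\<tau> (Suc n) = (E, F, k)" by (cases "\<tau> (Suc n)") auto
      obtain Y where "condition Y" "Y \<subseteq> Z" "decides (1 / real (Suc k)) E F Y"
        using decides_exists Z by blast
      then show ?thesis using Z \<tau> by (intro exI[of _ Y]) auto
    qed
  qed
  then obtain Z where "\<forall>n. (condition (Z n) \<and> Z n \<subseteq> Z0 \<and>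
      (case \<tau> n of (E, F, k) \<Rightarrow> decides (1 / real (Suc k)) E F (Z n))) \<and> Z (Suc n) \<subseteq> Z n" ..
  then have Z: "condition (Z n)" "Z n \<subseteq> Z0" "Z (Suc n) \<subseteq> Z n"
      "case \<tau> n of (E, F, k) \<Rightarrow> decides (1 / real (Suc k)) E F (Z n)" for n
    by (simp_all del: of_nat_Suc)
  obtain Y where Y: "condition Y" "Y \<subseteq> Z 0" "\<And>n. \<exists>t. finite t \<and> t \<subseteq> W \<and> Y \<inter> annihilator t \<subseteq> Z n"
    using diagonal_condition[of Z] Z(1,3) by blast
  have "decides (1 / real (Suc k)) E F Y" if EF: "finite E" "E \<subseteq> W" "finite F" "F \<subseteq> W" for E F k
  proof -
    have "(E, F, k) \<in> T" using EF by (simp add: T_def P_def)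
    then obtain n where n: "\<tau> n = (E, F, k)"
      using from_nat_into_surj[OF cT] unfolding \<tau>_def by metis
    then have "decides (1 / real (Suc k)) E F (Z n)" using Z(4)[of n] by simp
    then show ?thesis using Y(3)[of n] decides_almost_subset by blast
  qed
  then show thesis using that Y Z(2)[of 0] by (meson order_trans)
qed

text \<open>If \<open>U1, V1\<close> witness that \<open>(E, F)\<close> is not accepted by \<open>U\<close>, then enlarging \<open>E\<close> by vectors of
  \<open>U1\<close> does not change \<open>span E + U1\<close>, and likewise for \<open>F\<close> and \<open>V1\<close>.\<close>

lemma not_accepts_extend_left:
  assumes "\<not> accepts \<epsilon> E F U"
  obtains U' where "condition U'" "U' \<subseteq> U" "\<And>G. G \<subseteq> U' \<Longrightarrow> \<not> accepts \<epsilon> (E \<union> G) F U"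
proof -
  obtain U1 V1 where UV: "condition U1" "condition V1" "U1 \<subseteq> U" "V1 \<subseteq> U"
    and no: "\<And>e u f v. e \<in> span E \<Longrightarrow> u \<in> U1 \<Longrightarrow> f \<in> span F \<Longrightarrow> v \<in> V1 \<Longrightarrow>
      \<not> norm ((e + u) - (f + v)) < \<epsilon> * norm ((e + u) + (f + v))"
    using assms unfolding accepts_def by blast
  have "\<not> accepts \<epsilon> (E \<union> G) F U" if G: "G \<subseteq> U1" for G
  proof
    assume "accepts \<epsilon> (E \<union> G) F U"
    then obtain e u f v where *: "e \<in> span (E \<union> G)" "u \<in> U1" "f \<in> span F" "v \<in> V1"
        "norm ((e + u) - (f + v)) < \<epsilon> * norm ((e + u) + (f + v))"
      using UV unfolding accepts_def by blast
    then obtain e' g where e': "e' \<in> span E" "g \<in> span G" "e = e' + g" by (auto simp: span_Un)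
    have "g + u \<in> U1"
      using e' * G span_minimal[OF G condition_subspace[OF UV(1)]] condition_subspace[OF UV(1)]
      by (auto intro: subspace_add)
    from no[OF e'(1) this *(3,4)] show False using * e' by (simp add: add.assoc)
  qed
  then show thesis using that UV by blast
qed

lemma accepts_commute: "accepts \<epsilon> E F Z \<longleftrightarrow> accepts \<epsilon> F E Z"
proof -
  have "accepts \<epsilon> F E Z" if acc: "accepts \<epsilon> E F Z" for E F
    unfolding accepts_def
  proof (intro allI impI)
    fix U V assume "condition U \<and> condition V \<and> U \<subseteq> Z \<and> V \<subseteq> Z"
    then obtain e u f v where *: "e \<in> span E" "u \<in> V" "f \<in> span F" "v \<in> U"
        "norm ((e + u) - (f + v)) < \<epsilon> * norm ((e + u) + (f + v))"
      using acc unfolding accepts_def by blast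
    have "norm ((f + v) - (e + u)) < \<epsilon> * norm ((f + v) + (e + u))"
      using *(5) by (simp only: norm_minus_commute[of "f + v" "e + u"] add.commute[of "f + v" "e + u"])
    then show "\<exists>e\<in>span F. \<exists>u\<in>U. \<exists>f\<in>span E. \<exists>v\<in>V.
        norm ((e + u) - (f + v)) < \<epsilon> * norm ((e + u) + (f + v))"
      using * by blast
  qed
  then show ?thesis by blast
qed

text \<open>The assumption on \<open>P\<close> is what a deciding \<open>Z\<close> provides: non-acceptance by \<open>Z\<close> passes down to
  all conditions in \<open>Z\<close>, so \<open>not_accepts_extend_left\<close> can be applied repeatedly to shrinking
  conditions, for both components of the finitely many pairs.\<close>

lemma not_accepts_extend:
  assumes "condition U" "finite P" "\<And>E F. (E, F) \<in> P \<Longrightarrow> \<not> accepts \<epsilon> E F Z"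
    and "U \<subseteq> Z"
    and dec: "\<And>E F U. (E, F) \<in> P \<Longrightarrow> condition U \<Longrightarrow> U \<subseteq> Z \<Longrightarrow> \<not> accepts \<epsilon> E F U"
  shows "\<exists>U'. condition U' \<and> U' \<subseteq> U \<and> (\<forall>(E, F)\<in>P. \<forall>G\<subseteq>U'.
    \<not> accepts \<epsilon> (E \<union> G) F Z \<and> \<not> accepts \<epsilon> E (F \<union> G) Z)"
  using assms(2,3) dec
proof (induction P)
  case empty then show ?case using assms(1) by auto
next
  case (insert p P)
  obtain E F where p: "p = (E, F)" by (cases p)
  have "\<exists>U'. condition U' \<and> U' \<subseteq> U \<and> (\<forall>(E, F)\<in>P. \<forall>G\<subseteq>U'.
    \<not> accepts \<epsilon> (E \<union> G) F Z \<and> \<not> accepts \<epsilon> E (F \<union> G) Z)"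
    by (rule insert.IH) (use insert.prems in auto)
  then obtain U0 where U0: "condition U0" "U0 \<subseteq> U"
    "\<forall>(E, F)\<in>P. \<forall>G\<subseteq>U0. \<not> accepts \<epsilon> (E \<union> G) F Z \<and> \<not> accepts \<epsilon> E (F \<union> G) Z"
    by blast
  have "\<not> accepts \<epsilon> E F U0" using insert.prems(2)[of E F U0] p U0 assms(4) by auto
  then obtain U1 where U1: "condition U1" "U1 \<subseteq> U0" "\<And>G. G \<subseteq> U1 \<Longrightarrow> \<not> accepts \<epsilon> (E \<union> G) F U0"
    using not_accepts_extend_left by blast
  have "\<not> accepts \<epsilon> F E U1"
    using insert.prems(2)[of E F U1] p U0 U1 assms(4) accepts_commute by auto
  then obtain U2 where U2: "condition U2" "U2 \<subseteq> U1" "\<And>G. G \<subseteq> U2 \<Longrightarrow> \<not> accepts \<epsilon> (F \<union> G) E U1"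
    using not_accepts_extend_left by blast
  have "\<not> accepts \<epsilon> (E \<union> G) F Z \<and> \<not> accepts \<epsilon> E (F \<union> G) Z" if G: "G \<subseteq> U2" for G
  proof
    have "\<not> accepts \<epsilon> (E \<union> G) F U0" using U1(3) U2(2) G by blast
    then show "\<not> accepts \<epsilon> (E \<union> G) F Z" using accepts_mono U0(2) assms(4) by blast
    have "\<not> accepts \<epsilon> E (F \<union> G) U1" using U2(3)[OF G] accepts_commute by blast
    then show "\<not> accepts \<epsilon> E (F \<union> G) Z"
      using accepts_mono[of \<epsilon> E "F \<union> G" Z U1] U0(2) U1(2) assms(4) by blast
  qed
  moreover have "\<forall>(E, F)\<in>P. \<forall>G\<subseteq>U2. \<not> accepts \<epsilon> (E \<union> G) F Z \<and> \<not> accepts \<epsilon> E (F \<union> G) Z"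
  proof (clarify)
    fix E F G assume EF: "(E, F) \<in> P" and "G \<subseteq> U2"
    then have "G \<subseteq> U0" using U1(2) U2(2) by blast
    then show "\<not> accepts \<epsilon> (E \<union> G) F Z \<and> \<not> accepts \<epsilon> E (F \<union> G) Z"
      using bspec[OF U0(3) EF] by simp
  qed
  ultimately show ?case using U0(2) U1(2) U2(1,2) p by (intro exI[of _ U2]) auto
qed

end

section \<open>The dichotomy\<close>

context degree_frame
begin

text \<open>For rational \<open>Z\<close>, the perturbation can be taken into the dense subset \<open>Z \<inter> W\<close>, so that the
  perturbed space is rational.\<close>

lemma perturb_to_condition:
  assumes Z: "condition Z" and A: "subspace A" "closed A" "large A" "A \<subseteq> closure Z"
    and \<eta>: "0 < \<eta>" "\<eta> \<le> 1/2"
  obtains U where "condition U" "U \<subseteq> Z" "\<And>x. x \<in> U \<Longrightarrow> \<exists>a\<in>A. norm (x - a) \<le> \<eta> * norm a"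
proof -
  have rZ: "rational Z" using Z by (simp add: condition_def)
  have "closure Z \<subseteq> closure (Z \<inter> W)" by (intro closure_minimal rational_dense(1)[OF rZ]) simp
  then have "A \<subseteq> closure (Z \<inter> W)" using A(4) by blast
  then obtain w :: "nat \<Rightarrow> 'a" where w: "range w \<subseteq> Z \<inter> W" "large (span (range w))"
      "\<And>x. x \<in> span (range w) \<Longrightarrow> \<exists>a\<in>A. norm (x - a) \<le> \<eta> * norm a"
    using perturb_into_dense[OF A(1-3) _ rational_dense(2)[OF rZ] \<eta>] by blast
  have "condition (span (range w))" using w by (auto simp: condition_def intro: rational_span)
  moreover have "span (range w) \<subseteq> Z" using w(1) by (intro span_minimal condition_subspace[OF Z]) auto
  ultimately show thesis using that w(3) by blast
qed

text \<open>In a direct sum of large subspaces with projections of norm at most \<open>C\<close>, vectors \<open>a\<close> and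
  \<open>b\<close> of the summands satisfy \<open>norm (a + b) \<le> 2 * C * norm (a - b)\<close>. With a worse constant, this
  survives a small perturbation of the summands and contradicts acceptance for a small \<open>\<epsilon>\<close>.\<close>

lemma indecomposable_if_accepts:
  assumes Z: "condition Z" and acc: "\<And>k. accepts (1 / real (Suc k)) {} {} Z"
  shows "hereditarily_indecomposable d (closure Z)"
  unfolding hereditarily_indecomposable_def
proof (rule conjI[OF _ notI])
  have sZ: "subspace Z" and lZ: "large Z" using Z by (auto simp: condition_def rational_subspace)
  show "d_large d (closure Z) norm"
    using d_large_iff_large[of "closure Z"] large_closure[OF sZ lZ] subspace_closure[OF sZ] by simp
  assume "\<exists>Y A B. Y \<subseteq> closure Z \<and> inf_closed_subspace Y \<and> inf_closed_subspace A \<and>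
    inf_closed_subspace B \<and> topological_direct_sum Y A B \<and> d_large d A norm \<and> d_large d B norm"
  then obtain Y A B where Y: "Y \<subseteq> closure Z" and inf: "inf_closed_subspace A" "inf_closed_subspace B"
    and sum: "topological_direct_sum Y A B" and lAB: "d_large d A norm" "d_large d B norm"
    by blast
  have A: "subspace A" "closed A" "large A" and B: "subspace B" "closed B" "large B"
    using inf lAB d_large_iff_large by (auto simp: inf_closed_subspace_def)
  have Yeq: "Y = {a + b | a b. a \<in> A \<and> b \<in> B}" using sum by (simp add: topological_direct_sum_def)
  have "A \<subseteq> Y"
  proof
    fix a assume "a \<in> A"
    then have "a + 0 \<in> Y" unfolding Yeq using subspace_0[OF B(1)] by blast
    then show "a \<in> Y" by simp
  qed
  then have AZ: "A \<subseteq> closure Z" using Y by blast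
  have "B \<subseteq> Y"
  proof
    fix b assume "b \<in> B"
    then have "0 + b \<in> Y" unfolding Yeq using subspace_0[OF A(1)] by blast
    then show "b \<in> Y" by simp
  qed
  then have BZ: "B \<subseteq> closure Z" using Y by blast
  obtain C0 where C0: "\<And>a b. a \<in> A \<Longrightarrow> b \<in> B \<Longrightarrow>
      norm a \<le> C0 * norm (a + b) \<and> norm b \<le> C0 * norm (a + b)"
    using sum unfolding topological_direct_sum_def by metis
  define C where "C = max C0 1"
  have C: "1 \<le> C" "C0 \<le> C" by (auto simp: C_def)
  have proj: "norm a \<le> C * norm (a - b)" "norm b \<le> C * norm (a - b)" if "a \<in> A" "b \<in> B" for a b
    using C0[OF that(1) subspace_neg[OF B(1) that(2)]] mult_right_mono[OF C(2), of "norm (a - b)"]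
    by auto
  \<comment> \<open>The perturbations of \<open>a\<close> and \<open>b\<close> together will be at most half of \<open>norm (a - b)\<close>.\<close>
  define \<eta> where "\<eta> = 1 / (4 * C)"
  have \<eta>: "0 < \<eta>" "\<eta> \<le> 1/2" using C by (auto simp: \<eta>_def field_simps)
  obtain U where U: "condition U" "U \<subseteq> Z" "\<And>x. x \<in> U \<Longrightarrow> \<exists>a\<in>A. norm (x - a) \<le> \<eta> * norm a"
    using perturb_to_condition[OF Z A AZ \<eta>] by blast
  obtain V where V: "condition V" "V \<subseteq> Z" "\<And>x. x \<in> V \<Longrightarrow> \<exists>b\<in>B. norm (x - b) \<le> \<eta> * norm b"
    using perturb_to_condition[OF Z B BZ \<eta>] by blast
  \<comment> \<open>For the perturbed vectors, \<open>norm (u + v) \<le> 8 * C * norm (u - v)\<close> will hold.\<close>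
  obtain k :: nat where k: "8 * C \<le> k" using real_arch_simple by blast
  have "\<exists>e\<in>span {}. \<exists>u\<in>U. \<exists>f\<in>span {}. \<exists>v\<in>V.
      norm ((e + u) - (f + v)) < 1 / real (Suc k) * norm ((e + u) + (f + v))"
    using acc[of k] U(1,2) V(1,2) unfolding accepts_def by blast
  then obtain u v where uv: "u \<in> U" "v \<in> V" "norm (u - v) < 1 / real (Suc k) * norm (u + v)"
    by (auto simp del: of_nat_Suc)
  obtain a b where a: "a \<in> A" "norm (u - a) \<le> \<eta> * norm a" and b: "b \<in> B" "norm (v - b) \<le> \<eta> * norm b"
    using U(3) V(3) uv by blast
  let ?\<delta> = "norm (a - b)"
  have pert: "norm (u - a) \<le> ?\<delta> / 4" "norm (v - b) \<le> ?\<delta> / 4"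
  proof -
    have "\<eta> * norm a \<le> \<eta> * (C * ?\<delta>)" "\<eta> * norm b \<le> \<eta> * (C * ?\<delta>)"
      using proj[OF a(1) b(1)] \<eta> by auto
    moreover have "\<eta> * (C * ?\<delta>) = ?\<delta> / 4" using C by (simp add: \<eta>_def)
    ultimately show "norm (u - a) \<le> ?\<delta> / 4" "norm (v - b) \<le> ?\<delta> / 4" using a b by auto
  qed
  have "norm ((u - v) - ((u - a) - (v - b))) \<le> norm (u - v) + (norm (u - a) + norm (v - b))"
    using norm_triangle_ineq4[of "u - v" "(u - a) - (v - b)"]
      norm_triangle_ineq4[of "u - a" "v - b"] by linarith
  then have low: "?\<delta> / 2 \<le> norm (u - v)" using pert by (simp add: algebra_simps)
  have "norm ((a + b) + ((u - a) + (v - b))) \<le> norm a + norm b + (norm (u - a) + norm (v - b))"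
    using norm_triangle_ineq[of "a + b" "(u - a) + (v - b)"] norm_triangle_ineq[of a b]
      norm_triangle_ineq[of "u - a" "v - b"] by linarith
  then have "norm (u + v) \<le> norm a + norm b + (norm (u - a) + norm (v - b))"
    by (simp add: algebra_simps)
  also have "\<dots> \<le> C * ?\<delta> + C * ?\<delta> + (?\<delta> / 4 + ?\<delta> / 4)"
    using proj[OF a(1) b(1)] pert by linarith
  also have "\<dots> \<le> 4 * (C * ?\<delta>)"
    using mult_right_mono[OF C(1) norm_ge_zero[of "a - b"]] norm_ge_zero[of "a - b"] by linarith
  finally have "1 / real (Suc k) * norm (u + v) \<le> 1 / real (Suc k) * (4 * (C * ?\<delta>))"
    by (intro mult_left_mono) auto
  also have "\<dots> \<le> 1 / (8 * C) * (4 * (C * ?\<delta>))"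
    using k C by (intro mult_right_mono divide_left_mono) auto
  also have "\<dots> = ?\<delta> / 2" using C by simp
  finally show False using uv(3) low by linarith
qed

text \<open>The zero vectors of the witnesses of non-acceptance already give an estimate for \<open>E\<close> and \<open>F\<close>.\<close>

lemma not_accepts_split:
  assumes "\<not> accepts \<epsilon> E F Z" "e \<in> span E" "f \<in> span F"
  shows "\<epsilon> * norm (e + f) \<le> norm (e - f)"
proof -
  obtain U V where "condition U" "condition V"
    and no: "\<And>u v. u \<in> U \<Longrightarrow> v \<in> V \<Longrightarrow>
      \<not> norm ((e + u) - (f + v)) < \<epsilon> * norm ((e + u) + (f + v))"
    using assms unfolding accepts_def by blast
  then show ?thesis using no[of 0 0] subspace_0[OF condition_subspace] by simp
qed

text \<open>The values of \<open>f\<close> are pairs of a condition and the spanning set of a block taken from it. The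
  conditions decrease, which makes the tails of the block sequence lie in the spaces in which the
  degrees of the blocks are large. Each step treats the finitely many ways of distributing the
  earlier blocks to two sets.\<close>

lemma UFDD_if_not_accepts:
  assumes Z: "condition Z"
    and dec: "\<And>E F. finite E \<Longrightarrow> E \<subseteq> W \<Longrightarrow> finite F \<Longrightarrow> F \<subseteq> W \<Longrightarrow> decides \<epsilon> E F Z"
    and no: "\<not> accepts \<epsilon> {} {} Z" and \<epsilon>: "0 < \<epsilon>"
  shows "\<exists>Y F. Y \<subseteq> closure Z \<and> inf_closed_subspace Y \<and> large Y \<and> UFDD Y F \<and> d_better d Y F"
proof -
  define pair where "pair = (\<lambda>(f :: nat \<Rightarrow> 'a set \<times> 'a set) n A.
    (\<Union>i\<in>A. snd (f i), \<Union>i\<in>{..<n} - A. snd (f i)))"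
  define Good where "Good = (\<lambda>f n r. condition (fst r) \<and> fst r \<subseteq> Z \<and> (\<forall>m<n. fst r \<subseteq> fst (f m)) \<and>
    fits (fst r) (\<Union>i<n. snd (f i)) n (snd r) \<and>
    (\<forall>A\<subseteq>{..<n}. case pair f n A of (E, F) \<Rightarrow>
       \<not> accepts \<epsilon> (E \<union> snd r) F Z \<and> \<not> accepts \<epsilon> E (F \<union> snd r) Z))"
  have rejected: "\<not> accepts \<epsilon> (fst (pair f n A)) (snd (pair f n A)) Z"
    if G: "\<And>m. m < n \<Longrightarrow> Good f m (f m)" and A: "A \<subseteq> {..<n}" for f n A
  proof (cases n)
    case 0
    then show ?thesis using no A by (simp add: pair_def)
  next
    case (Suc m)
    define A' where "A' = A - {m}"
    have A': "A' \<subseteq> {..<m}" using A Suc by (auto simp: A'_def)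
    have "\<not> accepts \<epsilon> (fst (pair f m A') \<union> snd (f m)) (snd (pair f m A')) Z"
      "\<not> accepts \<epsilon> (fst (pair f m A')) (snd (pair f m A') \<union> snd (f m)) Z"
      using G[of m] Suc A' unfolding Good_def by (auto split: prod.splits)
    moreover have "pair f n A = (if m \<in> A then (fst (pair f m A') \<union> snd (f m), snd (pair f m A'))
        else (fst (pair f m A'), snd (pair f m A') \<union> snd (f m)))"
    proof (cases "m \<in> A")
      case True
      then have "A = insert m A'" "{..<n} - A = {..<m} - A'" using Suc by (auto simp: A'_def less_Suc_eq)
      then show ?thesis using True by (simp add: pair_def Un_commute)
    next
      case False
      then have "A = A'" "{..<n} - A = insert m ({..<m} - A')" using Suc by (auto simp: A'_def less_Suc_eq)
      then show ?thesis using False by (simp add: pair_def Un_commute)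
    qed
    ultimately show ?thesis by (cases "m \<in> A") auto
  qed
  have "\<exists>f. \<forall>n. Good f n (f n)"
  proof (rule dependent_wellorder_choice)
    fix r n and f g :: "nat \<Rightarrow> 'a set \<times> 'a set"
    assume eq: "\<And>m. m < n \<Longrightarrow> f m = g m"
    have "pair f n A = pair g n A" if "A \<subseteq> {..<n}" for A
    proof -
      have "f i = g i" if "i \<in> A" for i using eq that \<open>A \<subseteq> {..<n}\<close> by auto
      then show ?thesis using eq by (simp add: pair_def)
    qed
    then show "Good f n r = Good g n r" using eq by (simp add: Good_def cong: conj_cong)
  next
    fix n f assume G: "\<And>m. m < n \<Longrightarrow> Good f m (f m)"
    define U where "U = (if n = 0 then Z else fst (f (n - 1)))"
    have U: "condition U" "U \<subseteq> Z" using Z G[of "n - 1"] by (auto simp: U_def Good_def)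
    have Um: "U \<subseteq> fst (f m)" if "m < n" for m
      using that G[of "n - 1"] by (cases "m = n - 1") (auto simp: U_def Good_def)
    have blk: "finite (snd (f m))" "snd (f m) \<subseteq> W" if "m < n" for m
      using G[OF that] by (auto simp: Good_def fits_def)
    define P where "P = pair f n ` Pow {..<n}"
    have P: "\<not> accepts \<epsilon> E F Z" "finite E" "E \<subseteq> W" "finite F" "F \<subseteq> W" if EF: "(E, F) \<in> P" for E F
    proof -
      obtain A where A: "A \<subseteq> {..<n}" "(E, F) = pair f n A" using EF by (auto simp: P_def)
      show "\<not> accepts \<epsilon> E F Z" using rejected[OF G A(1)] A(2)[symmetric] by simp
      have EFeq: "E = (\<Union>i\<in>A. snd (f i))" "F = (\<Union>i\<in>{..<n} - A. snd (f i))"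
        using A(2) by (auto simp: pair_def)
      have "finite A" using A(1) finite_subset by blast
      then show "finite E" "finite F" unfolding EFeq using A(1) blk(1) by auto
      show "E \<subseteq> W" unfolding EFeq using A(1) blk(2) by (intro UN_least) auto
      show "F \<subseteq> W" unfolding EFeq using blk(2) by (intro UN_least) auto
    qed
    have "\<exists>U'. condition U' \<and> U' \<subseteq> U \<and> (\<forall>(E, F)\<in>P. \<forall>G\<subseteq>U'.
        \<not> accepts \<epsilon> (E \<union> G) F Z \<and> \<not> accepts \<epsilon> E (F \<union> G) Z)"
    proof (rule not_accepts_extend[OF U(1) _ P(1) U(2)])
      show "finite P" by (simp add: P_def)
      show "\<not> accepts \<epsilon> E F Y" if "(E, F) \<in> P" "condition Y" "Y \<subseteq> Z" for E F Y
        using dec[OF P(2-5)[OF that(1)]] P(1)[OF that(1)] that(2,3) unfolding decides_def by blast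
    qed
    then obtain U' where U': "condition U'" "U' \<subseteq> U"
      and ext: "\<forall>(E, F)\<in>P. \<forall>G\<subseteq>U'. \<not> accepts \<epsilon> (E \<union> G) F Z \<and> \<not> accepts \<epsilon> E (F \<union> G) Z"
      by (elim exE conjE)
    have "finite (\<Union>i<n. snd (f i))" "(\<Union>i<n. snd (f i)) \<subseteq> W" using blk by auto
    then obtain s where s: "fits U' (\<Union>i<n. snd (f i)) n s" using fits_exists[OF U'(1)] by blast
    have sU: "s \<subseteq> U'" using s by (auto simp: fits_def)
    have "case pair f n A of (E, F) \<Rightarrow> \<not> accepts \<epsilon> (E \<union> s) F Z \<and> \<not> accepts \<epsilon> E (F \<union> s) Z"
      if "A \<subseteq> {..<n}" for A
    proof -
      obtain E F where EF: "pair f n A = (E, F)" by (cases "pair f n A")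
      have "pair f n A \<in> P" using that by (simp add: P_def)
      then show ?thesis using bspec[OF ext] EF sU by auto
    qed
    moreover have "U' \<subseteq> Z" "\<forall>m<n. U' \<subseteq> fst (f m)" using U' U(2) Um by blast+
    ultimately have "Good f n (U', s)" using U'(1) s unfolding Good_def by simp
    then show "\<exists>r. Good f n r" by blast
  qed
  then obtain f where f: "\<And>n. Good f n (f n)" by blast
  define U where "U = (\<lambda>n. fst (f n))"
  define s where "s = (\<lambda>n. snd (f n))"
  have U: "condition (U n)" "U n \<subseteq> Z" for n using f[of n] by (auto simp: Good_def U_def)
  have mono: "U n \<subseteq> U m" if "m \<le> n" for m n
    using f[of n] that by (cases "m = n") (auto simp: Good_def U_def)
  have fits: "fits (U n) (\<Union>i<n. s i) n (s n)" for n
    using f[of n] by (simp add: Good_def U_def s_def)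
  interpret degree_blocks d K s
    using fits mono U by (intro degree_blocks_fits) (auto simp: condition_subspace)
  have "UFDD whole (\<lambda>n. span (s n))"
  proof (rule UFDD_blocks[OF \<epsilon>])
    fix n A e g
    assume A: "A \<subseteq> {..<n}" and e: "e \<in> span (\<Union>i\<in>A. s i)" and g: "g \<in> span (\<Union>i\<in>{..<n} - A. s i)"
    show "\<epsilon> * norm (e + g) \<le> norm (e - g)"
      using not_accepts_split[OF rejected[OF f A], of e g] e g by (simp add: pair_def s_def)
  qed
  moreover have "whole \<subseteq> closure Z"
  proof (intro closure_mono span_minimal condition_subspace[OF Z] UN_least)
    show "s n \<subseteq> Z" for n using fits[of n] U(2)[of n] by (auto simp: fits_def)
  qed
  moreover have lw: "large whole" by (intro large_closure large_span subspace_span)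
  moreover have "inf_closed_subspace whole"
    using large_not_fin_dim[OF subspace_whole lw] subspace_whole by (simp add: inf_closed_subspace_def)
  ultimately show ?thesis using d_better_blocks by blast
qed

lemma dichotomy:
  assumes Z0: "condition Z0"
  shows "\<exists>Y. Y \<subseteq> closure Z0 \<and> inf_closed_subspace Y \<and> d_large d Y norm \<and>
    ((\<exists>F. UFDD Y F \<and> d_better d Y F) \<or> hereditarily_indecomposable d Y)"
proof -
  obtain Z where Z: "condition Z" "Z \<subseteq> Z0"
    and dec: "\<And>E F k. finite E \<Longrightarrow> E \<subseteq> W \<Longrightarrow> finite F \<Longrightarrow> F \<subseteq> W \<Longrightarrow> decides (1 / real (Suc k)) E F Z"
    using decides_all[OF Z0] by blast
  have ZZ0: "closure Z \<subseteq> closure Z0" using Z(2) by (rule closure_mono)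
  show ?thesis
  proof (cases "\<forall>k. accepts (1 / real (Suc k)) {} {} Z")
    case True
    then have hi: "hereditarily_indecomposable d (closure Z)" by (intro indecomposable_if_accepts Z(1)) simp
    have sc: "subspace (closure Z)" by (intro subspace_closure condition_subspace Z(1))
    have "large (closure Z)"
      using Z(1) by (intro large_closure condition_subspace) (auto simp: condition_def)
    then have "inf_closed_subspace (closure Z)"
      using large_not_fin_dim[OF sc] sc by (simp add: inf_closed_subspace_def)
    then show ?thesis using hi ZZ0 by (auto simp: hereditarily_indecomposable_def intro!: exI[of _ "closure Z"])
  next
    case False
    then obtain k where "\<not> accepts (1 / real (Suc k)) {} {} Z" by blast
    then obtain Y F where Y: "Y \<subseteq> closure Z" "inf_closed_subspace Y" "large Y" "UFDD Y F" "d_better d Y F"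
      using UFDD_if_not_accepts[OF Z(1) dec, of k] by auto
    then have "d_large d Y norm" using d_large_iff_large[of Y] by (simp add: inf_closed_subspace_def)
    then show ?thesis using Y ZZ0 by blast
  qed
qed

end

theorem theorem4p5:
  fixes X :: "'a::banach set"
    and d :: "'a set \<Rightarrow> ('a \<Rightarrow> real) \<Rightarrow> 'a set \<Rightarrow> real"
  assumes "inf_closed_subspace X"
    and "is_degree d"
    and "d_large d X norm"
  shows "\<exists>Y. Y \<subseteq> X \<and> inf_closed_subspace Y \<and> d_large d Y norm \<and>
           ((\<exists>F. UFDD Y F \<and> d_better d Y F) \<or> hereditarily_indecomposable d Y)"
proof -
  have X: "subspace X" "closed X" using assms(1) by (auto simp: inf_closed_subspace_def)
  obtain K :: "real \<Rightarrow> real \<Rightarrow> real" where nonneg: "\<forall>V N F. approx_pair V N F \<longrightarrow> 0 \<le> d V N F"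
    and mono: "\<forall>s s' t t'. 1 \<le> s \<and> s \<le> s' \<and> 0 \<le> t \<and> t \<le> t' \<longrightarrow> K s t \<le> K s' t'"
    and lim: "\<forall>t\<ge>0. ((\<lambda>s. K s t) \<longlongrightarrow> t) (at_right 1)"
    and functorial: "\<forall>V N F W M G S T.
      approx_pair V N F \<and> approx_pair W M G \<and> morphism V N F W M G S T
      \<longrightarrow> d W M G \<le> K (morphism_norm V N M G S T) (d V N F)"
    using assms(2) unfolding is_degree_def by (elim exE conjE)
  have K: "degree d K"
    by unfold_locales (use nonneg mono lim functorial in simp_all)
  interpret degree d K by (rule K)
  have "large X" using assms(3) d_large_iff_large[OF X] by blast
  then have "\<exists>B. finite B \<and> B \<subseteq> X \<and> real n < d X norm (span B)" for n
    using X(2) by (simp add: large_def closure_closed)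
  then obtain B where B: "\<And>n. finite (B n)" "\<And>n. B n \<subseteq> X" "\<And>n. real n < d X norm (span (B n))"
    by metis
  let ?D = "\<Union>n. B n"
  have "countable ?D" using B(1) by (auto intro: countable_finite)
  then obtain W N where WN: "frame W N" "?D \<subseteq> W" using frame_exists by blast
  interpret degree_frame d K W N using K WN(1) by (rule degree_frame.intro)
  have DX: "span ?D \<subseteq> X" using B(2) by (intro span_minimal X(1)) auto
  have "large (span ?D)"
  proof (rule large_subset[OF subspace_span DX X])
    fix M :: real
    obtain n :: nat where "M < n" using reals_Archimedean2 by blast
    moreover have "B n \<subseteq> span ?D" using span_superset[of ?D] by auto
    ultimately show "\<exists>B. finite B \<and> B \<subseteq> span ?D \<and> M < d X norm (span B)"
      using B(1,3)[of n] by (intro exI[of _ "B n"]) auto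
  qed
  then have "condition (span ?D)" using WN(2) by (simp add: condition_def rational_span)
  moreover have "closure (span ?D) \<subseteq> X" using DX X(2) by (rule closure_minimal)
  ultimately show ?thesis using dichotomy by (meson order_trans)
qed

end
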